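(* Let $\{\rho_\theta;\theta\in\Theta\}$ be a model as in the context, $g:\Theta\to\mathbb R$, $\theta\in\Theta$, $\delta\in\mathbb R\setminus\{0\}$ and $r\ge1$ an integer with $\theta+i\delta\in\Theta$ for $i=0,1,\dots,r$. Let $\mathbf v=(\Delta_{\delta,1}g(\theta),\dots,\Delta_{\delta,r}g(\theta))^T\in\mathbb R^r$ and let $K^S_{\theta,\delta}$, $K^R_{\theta,\delta}$ be the $r\times r$ matrices with entries $K^S_{\theta,\delta,i,j}=\mathrm{Tr}(\rho_\theta L^S_{\theta,\delta,i}L^S_{\theta,\delta,j})$ and $K^R_{\theta,\delta,i,j}=\mathrm{Tr}(\rho_\theta L^R_{\theta,\delta,i}(L^R_{\theta,\delta,j})^\dagger)$. If $M$ is an unbiased estimator of $g$, then \[ V_\theta(M)\ge \mathbf v^T(K^S_{\theta,\delta})^{-1}\mathbf v,\qquad V_\theta(M)\ge \mathbf v^T(K^R_{\theta,\delta})^{-1}\mathbf v, \] where $(\cdot)^{-1}$ denotes the Moore–Penrose generalized inverse. Equality holds in the first inequality if and only if $M$ is the spectral measure of a Hermitian operator $T$ with $T-g(\theta)I\in\mathrm{span}_{\mathbb R}\{L^S_{\theta,\delta,1},\dots,L^S_{\theta,\delta,r}\}$.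
   Context: $\mathcal H$ is a finite-dimensional complex Hilbert space; $\Theta\subset\mathbb R$; $\{\rho_\theta\}$ are density operators on $\mathcal H$ with $\rho_\theta>0$. An estimator of $g(\theta)$ is a POVM $M$ on the Borel sets of $\mathbb R$; bias $b(M,\theta)=\int(\gamma-g(\theta))\mathrm{Tr}(\rho_\theta M(d\gamma))$, MSE $V_\theta(M)=\int(\gamma-g(\theta))^2\mathrm{Tr}(\rho_\theta M(d\gamma))$; $M$ is unbiased if $b(M,\theta')=0$ for all $\theta'\in\Theta$. The $k$-th difference operator is $\Delta_{\delta,k}f(\theta)=(-1)^k\delta^{-k}\sum_{i=0}^k(-1)^i\binom{k}{i}f(\theta+i\delta)$ (applied also to $\rho_\theta$). $L^S_{\theta,\delta,k}$ (Hermitian) and $L^R_{\theta,\delta,k}$ are the unique solutions of $\Delta_{\delta,k}\rho_\theta=\tfrac12(\rho_\theta L^S_{\theta,\delta,k}+L^S_{\theta,\delta,k}\rho_\theta)$ and $\Delta_{\delta,k}\rho_\theta=\rho_\theta L^R_{\theta,\delta,k}$.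
   Formalization: The matrix K^S is taken with entries Re Tr(ρ_θ L^S_i L^S_j), the real symmetric part, instead of Tr(ρ_θ L^S_i L^S_j); with the complex entries the first inequality fails for noncommuting L^S_i (qubit example with L^S_1 ∝ σ_x, L^S_2 ∝ σ_y). *)

theory Defs
  imports "HOL-Analysis.Analysis" "Jordan_Normal_Form.Matrix"
begin

definition mtrace :: "complex mat \<Rightarrow> complex" where
  "mtrace A = (\<Sum>i<dim_row A. A $$ (i, i))"

definition adj :: "complex mat \<Rightarrow> complex mat" where
  "adj A = mat (dim_col A) (dim_row A) (\<lambda>(i, j). cnj (A $$ (j, i)))"

definition hermitian :: "nat \<Rightarrow> complex mat \<Rightarrow> bool" where
  "hermitian n A \<longleftrightarrow> A \<in> carrier_mat n n \<and> adj A = A"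

definition qform :: "nat \<Rightarrow> complex mat \<Rightarrow> complex vec \<Rightarrow> complex" where
  "qform n A v = (\<Sum>i<n. \<Sum>j<n. cnj (v $ i) * A $$ (i, j) * v $ j)"

definition psd :: "nat \<Rightarrow> complex mat \<Rightarrow> bool" where
  "psd n A \<longleftrightarrow> hermitian n A \<and> (\<forall>v\<in>carrier_vec n. 0 \<le> Re (qform n A v))"

definition posdef :: "nat \<Rightarrow> complex mat \<Rightarrow> bool" where
  "posdef n A \<longleftrightarrow> hermitian n A \<and> (\<forall>v\<in>carrier_vec n. v \<noteq> 0\<^sub>v n \<longrightarrow> 0 < Re (qform n A v))"

definition density_op :: "nat \<Rightarrow> complex mat \<Rightarrow> bool" where
  "density_op n A \<longleftrightarrow> psd n A \<and> mtrace A = 1"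

definition is_proj :: "nat \<Rightarrow> complex mat \<Rightarrow> bool" where
  "is_proj n P \<longleftrightarrow> hermitian n P \<and> P * P = P"

definition msum :: "nat \<Rightarrow> ('b \<Rightarrow> complex mat) \<Rightarrow> 'b set \<Rightarrow> complex mat" where
  "msum n f S = mat n n (\<lambda>(a, b). \<Sum>x\<in>S. f x $$ (a, b))"

definition mp_inverse :: "complex mat \<Rightarrow> complex mat" where
  "mp_inverse A = (THE X. X \<in> carrier_mat (dim_col A) (dim_row A) \<and>
      A * X * A = A \<and> X * A * X = X \<and> adj (A * X) = A * X \<and> adj (X * A) = X * A)"

definition diff_op :: "real \<Rightarrow> nat \<Rightarrow> (real \<Rightarrow> 'a::real_vector) \<Rightarrow> real \<Rightarrow> 'a" where
  "diff_op \<delta> k f \<theta> = ((-1) ^ k / \<delta> ^ k) *\<^sub>R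
      (\<Sum>i\<in>{0..k}. ((-1) ^ i * real (k choose i)) *\<^sub>R f (\<theta> + real i * \<delta>))"

definition diff_mat :: "nat \<Rightarrow> real \<Rightarrow> nat \<Rightarrow> (real \<Rightarrow> complex mat) \<Rightarrow> real \<Rightarrow> complex mat" where
  "diff_mat n \<delta> k \<rho> \<theta> = mat n n (\<lambda>(a, b). diff_op \<delta> k (\<lambda>t. \<rho> t $$ (a, b)) \<theta>)"

definition LS :: "nat \<Rightarrow> (real \<Rightarrow> complex mat) \<Rightarrow> real \<Rightarrow> real \<Rightarrow> nat \<Rightarrow> complex mat" where
  "LS n \<rho> \<theta> \<delta> k = (THE L. hermitian n L \<and>
      diff_mat n \<delta> k \<rho> \<theta> = (1/2 :: complex) \<cdot>\<^sub>m (\<rho> \<theta> * L + L * \<rho> \<theta>))"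

definition LR :: "nat \<Rightarrow> (real \<Rightarrow> complex mat) \<Rightarrow> real \<Rightarrow> real \<Rightarrow> nat \<Rightarrow> complex mat" where
  "LR n \<rho> \<theta> \<delta> k = (THE L. L \<in> carrier_mat n n \<and> diff_mat n \<delta> k \<rho> \<theta> = \<rho> \<theta> * L)"

definition is_povm :: "nat \<Rightarrow> (real set \<Rightarrow> complex mat) \<Rightarrow> bool" where
  "is_povm n M \<longleftrightarrow>
     (\<forall>A\<in>sets borel. psd n (M A)) \<and> M UNIV = 1\<^sub>m n \<and>
     (\<forall>F :: nat \<Rightarrow> real set. range F \<subseteq> sets borel \<longrightarrow> disjoint_family F \<longrightarrow>
        (\<forall>a<n. \<forall>b<n. (\<lambda>k. \<Sum>i<k. M (F i) $$ (a, b)) \<longlonglongrightarrow> M (\<Union>i. F i) $$ (a, b)))"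

definition outcome :: "complex mat \<Rightarrow> (real set \<Rightarrow> complex mat) \<Rightarrow> real measure" where
  "outcome \<rho> M = measure_of UNIV (sets borel) (\<lambda>A. ennreal (Re (mtrace (\<rho> * M A))))"

definition bias :: "(real \<Rightarrow> complex mat) \<Rightarrow> (real set \<Rightarrow> complex mat) \<Rightarrow> (real \<Rightarrow> real) \<Rightarrow> real \<Rightarrow> real" where
  "bias \<rho> M g \<theta> = (\<integral>\<gamma>. (\<gamma> - g \<theta>) \<partial>outcome (\<rho> \<theta>) M)"

definition mse :: "(real \<Rightarrow> complex mat) \<Rightarrow> (real set \<Rightarrow> complex mat) \<Rightarrow> (real \<Rightarrow> real) \<Rightarrow> real \<Rightarrow> ennreal" where
  "mse \<rho> M g \<theta> = (\<integral>\<^sup>+\<gamma>. ennreal ((\<gamma> - g \<theta>)\<^sup>2) \<partial>outcome (\<rho> \<theta>) M)"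

definition unbiased :: "real set \<Rightarrow> (real \<Rightarrow> complex mat) \<Rightarrow> (real set \<Rightarrow> complex mat) \<Rightarrow> (real \<Rightarrow> real) \<Rightarrow> bool" where
  "unbiased \<Theta> \<rho> M g \<longleftrightarrow> (\<forall>\<theta>'\<in>\<Theta>.
      integrable (outcome (\<rho> \<theta>') M) (\<lambda>\<gamma>. \<gamma> - g \<theta>') \<and> bias \<rho> M g \<theta>' = 0)"

definition spectral_measure_of :: "nat \<Rightarrow> complex mat \<Rightarrow> (real set \<Rightarrow> complex mat) \<Rightarrow> bool" where
  "spectral_measure_of n T M \<longleftrightarrow> hermitian n T \<and>
     (\<exists>S :: real set. finite S \<and> (\<forall>x\<in>S. is_proj n (M {x})) \<and>
        msum n (\<lambda>x. M {x}) S = 1\<^sub>m n \<and>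
        T = msum n (\<lambda>x. complex_of_real x \<cdot>\<^sub>m M {x}) S \<and>
        (\<forall>A\<in>sets borel. M A = msum n (\<lambda>x. M {x}) (S \<inter> A)))"

definition KS :: "nat \<Rightarrow> (real \<Rightarrow> complex mat) \<Rightarrow> real \<Rightarrow> real \<Rightarrow> nat \<Rightarrow> complex mat" where
  "KS n \<rho> \<theta> \<delta> r = mat r r (\<lambda>(i, j).
      complex_of_real (Re (mtrace (\<rho> \<theta> * LS n \<rho> \<theta> \<delta> (i+1) * LS n \<rho> \<theta> \<delta> (j+1)))))"

definition KR :: "nat \<Rightarrow> (real \<Rightarrow> complex mat) \<Rightarrow> real \<Rightarrow> real \<Rightarrow> nat \<Rightarrow> complex mat" where
  "KR n \<rho> \<theta> \<delta> r = mat r r (\<lambda>(i, j).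
      mtrace (\<rho> \<theta> * LR n \<rho> \<theta> \<delta> (i+1) * adj (LR n \<rho> \<theta> \<delta> (j+1))))"

definition vdiff :: "(real \<Rightarrow> real) \<Rightarrow> real \<Rightarrow> real \<Rightarrow> nat \<Rightarrow> complex vec" where
  "vdiff g \<theta> \<delta> r = vec r (\<lambda>i. complex_of_real (diff_op \<delta> (i+1) g \<theta>))"

(* v^T K^{-1} v with Moore-Penrose inverse (real since v is real and K Hermitian) *)
definition crbound :: "complex mat \<Rightarrow> complex vec \<Rightarrow> nat \<Rightarrow> real" where
  "crbound K v r = Re (qform r (mp_inverse K) v)"

end

theory Submission
  imports "Jordan_Normal_Form.Spectral_Radius" Defs
begin

text \<open>
  For \<open>X = \<Sum> a\<^sub>k L\<^sub>k\<close> the operator-valued integral of \<open>(x - g \<theta> - X) M(dx) (x - g \<theta> - X)\<^sup>\<dagger>\<close>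
  is positive semidefinite. Its trace against \<open>\<rho>\<close> is
  \<open>V - 2 Re \<langle>a, v\<rangle> + Re (tr (\<rho> X X\<^sup>\<dagger>))\<close>, because unbiasedness at the points \<open>\<theta> + i\<delta>\<close>
  evaluates the cross term, and the last term is the Gram form of \<open>K\<close>. Choosing \<open>a\<close> through
  \<open>K\<^sup>- v\<close> gives \<open>V \<ge> v\<^sup>T K\<^sup>- v\<close>.

  In the case of equality diagonalize \<open>X = U diag(e) U\<^sup>\<dagger>\<close>. Since \<open>\<rho> \<ge> c > 0\<close>, the diagonal
  entries of \<open>U\<^sup>\<dagger> M(\<cdot>) U\<close> are probability measures with vanishing second moment about
  \<open>g \<theta> + e\<^sub>k\<close>, hence Dirac measures, and positivity kills the off-diagonal entries, so \<open>M\<close> is the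
  spectral measure of \<open>g \<theta> + X\<close>.
\<close>

section \<open>The spectral theorem for Hermitian matrices\<close>

text \<open>Both bounds come from one argument because a single identity is required of the
  derivatives: \<open>Re (a k * tr (\<rho> L_k P)) = Re (a k) * Re (tr (D_k P))\<close> for
  Hermitian \<open>P\<close>, with \<open>D_k\<close> the \<open>k\<close>-th difference of the
  states. For the right derivatives it holds with complex \<open>a k\<close>, since
  \<open>tr (\<rho> L_k P) = tr (D_k P)\<close> is real. For the symmetric ones only the real part
  of the trace is known, so \<open>a\<close> has to be real; hence the proof that the Moore-Penrose
  inverse of a real Hermitian matrix is real. With \<open>a\<close> the conjugate of
  \<open>K^- v\<close>, the equation \<open>K^- K K^- = K^-\<close> makes the linear and the
  quadratic term equal to the same number \<open>b = v^T K^- v\<close>, so that the defect is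
  \<open>V - 2 b + b\<close>. The converse of the equality claim works with moments. If
  \<open>M\<close> is the spectral measure of \<open>T\<close> and
  \<open>X = T - g \<theta> I\<close> is the combination of the \<open>L_k\<close> with real
  coefficients \<open>f\<close>, unbiasedness says
  \<open>tr (\<rho>_i X) = g (\<theta> + i \<delta>) - g \<theta>\<close>, where
  \<open>\<rho>_i\<close> is the state at \<open>\<theta> + i \<delta>\<close>. Taking differences
  gives \<open>v = K f\<close>, and \<open>K K^- K = K\<close> turns the bound into
  \<open>f^T K f = tr (\<rho> X^2) = V\<close>.\<close>

lemma adj_dim [simp]: "dim_row (adj A) = dim_col A" "dim_col (adj A) = dim_row A"
  by (simp_all add: adj_def)

lemma adj_carrier [simp]: "A \<in> carrier_mat m n \<Longrightarrow> adj A \<in> carrier_mat n m"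
  by (auto simp: adj_def)

lemma index_adj [simp]:
  "i < dim_col A \<Longrightarrow> j < dim_row A \<Longrightarrow> adj A $$ (i, j) = cnj (A $$ (j, i))"
  by (simp add: adj_def)

lemma adj_adj [simp]: "adj (adj A) = A"
  by (rule eq_matI) auto

lemma index_mult_sum:
  "A \<in> carrier_mat m k \<Longrightarrow> B \<in> carrier_mat k n \<Longrightarrow> i < m \<Longrightarrow> j < n \<Longrightarrow>
    (A * B) $$ (i, j) = (\<Sum>l<k. A $$ (i, l) * B $$ (l, j))"
  by (simp add: scalar_prod_def atLeast0LessThan)

text \<open>Entries of products are to be opened only on demand, as sums through
  \<open>index_mult_sum\<close>; the default rule would turn each of them into a scalar product of a
  row and a column.\<close>

declare index_mult_mat(1) [simp del]

lemma adj_mult: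
  assumes "A \<in> carrier_mat m k" "B \<in> carrier_mat k n"
  shows "adj (A * B) = adj B * adj A"
proof (rule eq_matI)
  fix i j assume "i < dim_row (adj B * adj A)" "j < dim_col (adj B * adj A)"
  then have ij: "i < n" "j < m" using assms by auto
  show "adj (A * B) $$ (i, j) = (adj B * adj A) $$ (i, j)"
    using assms ij
    by (simp add: index_mult_sum[of _ m k _ n] index_mult_sum[of _ n k _ m] mult.commute)
qed (use assms in auto)

lemma adj_one [simp]: "adj (1\<^sub>m n) = 1\<^sub>m n"
  by (rule eq_matI) auto

lemma adj_smult [simp]: "adj (c \<cdot>\<^sub>m A) = cnj c \<cdot>\<^sub>m adj A"
  by (rule eq_matI) auto

lemma adj_minus [simp]:
  "A \<in> carrier_mat m n \<Longrightarrow> B \<in> carrier_mat m n \<Longrightarrow> adj (A - B) = adj A - adj B"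
  by (rule eq_matI) auto

lemma adj_mat_diag_real [simp]:
  "adj (mat_diag n (\<lambda>i. complex_of_real (d i))) = mat_diag n (\<lambda>i. complex_of_real (d i))"
  by (rule eq_matI) (auto simp: mat_diag_def)

lemma hermitian_carrier: "hermitian n A \<Longrightarrow> A \<in> carrier_mat n n"
  by (simp add: hermitian_def)

lemma hermitian_adj: "hermitian n A \<Longrightarrow> adj A = A"
  by (simp add: hermitian_def)

lemma square_mult_carrier [simp]:
  "A \<in> carrier_mat n n \<Longrightarrow> B \<in> carrier_mat n n \<Longrightarrow> A * B \<in> carrier_mat n n"
  by (rule mult_carrier_mat)

text \<open>With one common dimension the side conditions leave nothing to guess, so
  \<open>square_assoc[of _ n]\<close> can normalize products to right-nested form by
  rewriting.\<close>

lemma square_assoc: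
  "A \<in> carrier_mat n n \<Longrightarrow> B \<in> carrier_mat n n \<Longrightarrow> C \<in> carrier_mat n n \<Longrightarrow>
    (A * B) * C = A * (B * C :: complex mat)"
  by (rule assoc_mult_mat)

lemma square_adj_mult:
  "A \<in> carrier_mat n n \<Longrightarrow> B \<in> carrier_mat n n \<Longrightarrow> adj (A * B) = adj B * adj A"
  by (rule adj_mult)

lemma hermitian_congruence:
  assumes "hermitian n A" "X \<in> carrier_mat n n"
  shows "hermitian n (adj X * A * X)"
  using assms by (simp add: hermitian_def square_adj_mult[of _ n] square_assoc[of _ n])

section \<open>Unitary matrices and diagonalization\<close>

definition unitary_mat :: "nat \<Rightarrow> complex mat \<Rightarrow> bool" where
  "unitary_mat n U \<longleftrightarrow> U \<in> carrier_mat n n \<and> adj U * U = 1\<^sub>m n \<and> U * adj U = 1\<^sub>m n"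

lemma unitary_matI:
  assumes "U \<in> carrier_mat n n" "adj U * U = 1\<^sub>m n"
  shows "unitary_mat n U"
  using assms mat_mult_left_right_inverse[of "adj U" n U] by (simp add: unitary_mat_def)

lemma unitary_mat_mult:
  assumes "unitary_mat n U" "unitary_mat n V"
  shows "unitary_mat n (U * V)"
proof (rule unitary_matI)
  have c: "U \<in> carrier_mat n n" "V \<in> carrier_mat n n"
    and i: "adj U * U = 1\<^sub>m n" "adj V * V = 1\<^sub>m n"
    using assms by (auto simp: unitary_mat_def)
  show "U * V \<in> carrier_mat n n" using c by simp
  have "adj (U * V) * (U * V) = adj V * (adj U * U) * V"
    using c by (simp add: square_assoc[of _ n] square_adj_mult[of _ n])
  then show "adj (U * V) * (U * V) = 1\<^sub>m n" using c i by simp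
qed

text \<open>Gram-Schmidt applied to a basis that starts with \<open>v\<close> keeps \<open>v\<close>
  in first place. Its output is orthogonal but not normalized; dividing the columns by their norms
  is what brings in the factor \<open>c\<close>.\<close>

lemma unitary_with_first_col:
  assumes v: "v \<in> carrier_vec n" "v \<noteq> 0\<^sub>v n"
  obtains W c where "unitary_mat n W" "\<And>i. i < n \<Longrightarrow> W $$ (i, 0) = c * (v $ i)"
proof -
  interpret cof_vec_space n "TYPE(complex)" .
  define ws where "ws = gram_schmidt n (basis_completion v)"
  note bc = basis_completion[OF v]
  note gs = gram_schmidt_result[OF bc(2,4,5) ws_def]
  have len: "length ws = n" using gs(4) bc(6) by simp
  have n: "n \<noteq> 0" using v by (metis eq_vecI carrier_vecD index_zero_vec(2) less_nat_zero_code)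
  then have "basis_completion v \<noteq> []" using bc(6) by auto
  then obtain us where us: "basis_completion v = v # us"
    using bc(7) by (metis list.collapse)
  have "hd ws = v" unfolding ws_def us by (rule gram_schmidt_hd[OF v(1)])
  then have hd: "ws ! 0 = v" using len n by (cases ws) auto
  have car: "ws ! j \<in> carrier_vec n" if "j < n" for j
    using gs(3) that len by auto
  define s where "s j = (\<Sum>k<n. (cmod (ws ! j $ k))\<^sup>2)" for j
  have ip: "ws ! i \<bullet>c ws ! j = (\<Sum>k<n. ws ! i $ k * cnj (ws ! j $ k))" if "i < n" "j < n" for i j
    using carrier_vecD[OF car[OF that(1)]] carrier_vecD[OF car[OF that(2)]]
    by (simp add: scalar_prod_def atLeast0LessThan)
  have sip: "ws ! i \<bullet>c ws ! i = complex_of_real (s i)" if "i < n" for i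
    using that by (simp add: ip s_def complex_norm_square del: of_real_power)
  have spos: "s i > 0" if "i < n" for i
  proof -
    have "s i \<noteq> 0" using corthogonalD[OF gs(2), of i i] that len sip by auto
    moreover have "s i \<ge> 0" by (simp add: s_def sum_nonneg)
    ultimately show ?thesis by simp
  qed
  define W where "W = Matrix.mat n n (\<lambda>(i, j). ws ! j $ i / complex_of_real (sqrt (s j)))"
  have W: "W \<in> carrier_mat n n" by (simp add: W_def)
  have "adj W * W = 1\<^sub>m n"
  proof (rule eq_matI)
    fix i j assume "i < dim_row (1\<^sub>m n :: complex mat)" "j < dim_col (1\<^sub>m n :: complex mat)"
    then have ij: "i < n" "j < n" by auto
    have "(adj W * W) $$ (i, j)
        = (\<Sum>k<n. cnj (W $$ (k, i)) * W $$ (k, j))"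
      using W ij by (simp add: index_mult_sum[of _ n n _ n])
    also have "\<dots> = (\<Sum>k<n. ws ! j $ k * cnj (ws ! i $ k)) / complex_of_real (sqrt (s i) * sqrt (s j))"
      using ij by (simp add: W_def sum_divide_distrib mult.commute)
    also have "\<dots> = (ws ! j \<bullet>c ws ! i) / complex_of_real (sqrt (s i) * sqrt (s j))"
      using ij by (simp add: ip)
    also have "\<dots> = 1\<^sub>m n $$ (i, j)"
    proof (cases "i = j")
      case True
      then show ?thesis using ij spos[of i] by (simp add: sip)
    next
      case False
      then show ?thesis using ij corthogonalD[OF gs(2), of j i] len by simp
    qed
    finally show "(adj W * W) $$ (i, j) = 1\<^sub>m n $$ (i, j)" .
  qed (use W in auto)
  then have "unitary_mat n W" by (rule unitary_matI[OF W])
  moreover have "W $$ (i, 0) = (1 / complex_of_real (sqrt (s 0))) * (v $ i)" if "i < n" for i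
    using that n hd by (simp add: W_def)
  ultimately show ?thesis by (rule that)
qed

text \<open>Serves to embed the unitary of the lower block next to a 1 by 1 identity in the
  induction below.\<close>

lemma block_diag_mult:
  fixes A A' B B' :: "complex mat"
  assumes "A \<in> carrier_mat k k" "A' \<in> carrier_mat k k" "B \<in> carrier_mat m m" "B' \<in> carrier_mat m m"
  shows "four_block_mat A (0\<^sub>m k m) (0\<^sub>m m k) B * four_block_mat A' (0\<^sub>m k m) (0\<^sub>m m k) B'
    = four_block_mat (A * A') (0\<^sub>m k m) (0\<^sub>m m k) (B * B')"
proof -
  have "A * A' \<in> carrier_mat k k" "B * B' \<in> carrier_mat m m" using assms by simp_all
  then have "A * A' + 0\<^sub>m k m * 0\<^sub>m m k = A * A'" "0\<^sub>m m k * 0\<^sub>m k m + B * B' = B * B'"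
    "A * 0\<^sub>m k m + 0\<^sub>m k m * B' = 0\<^sub>m k m" "0\<^sub>m m k * A' + B * 0\<^sub>m m k = 0\<^sub>m m k"
    using assms by (auto intro!: eq_matI)
  then show ?thesis
    by (subst mult_four_block_mat[of _ k k _ m _ m]) (use assms in auto)
qed

text \<open>Induction on the dimension by deflation: a unitary whose first column is an eigenvector
  splits off a 1 by 1 block, and the induction hypothesis diagonalizes the rest.\<close>

theorem hermitian_diagonalization:
  assumes "hermitian n A"
  obtains U d where "unitary_mat n U"
    "A = U * mat_diag n (\<lambda>i. complex_of_real (d i)) * adj U"
proof -
  have "\<exists>U d. unitary_mat n U \<and> A = U * mat_diag n (\<lambda>i. complex_of_real (d i)) * adj U"
    using assms
  proof (induction n arbitrary: A)
    case 0
    then have "A \<in> carrier_mat 0 0" by (simp add: hermitian_def)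
    then have "A = 1\<^sub>m 0 * mat_diag 0 (\<lambda>i. complex_of_real 0) * adj (1\<^sub>m 0)"
      by (intro eq_matI) auto
    moreover have "unitary_mat 0 (1\<^sub>m 0)" by (simp add: unitary_mat_def)
    ultimately show ?case by (intro exI[of _ "1\<^sub>m 0"] exI[of _ "\<lambda>_. 0"]) simp
  next
    case (Suc m)
    let ?n = "Suc m"
    have A: "A \<in> carrier_mat ?n ?n" using Suc.prems by (rule hermitian_carrier)
    from spectrum_non_empty[OF A] obtain e where "e \<in> spectrum A" by blast
    then obtain v where "eigenvector A v e"
      by (auto simp: spectrum_def eigenvalue_def)
    then have v: "v \<in> carrier_vec ?n" "v \<noteq> 0\<^sub>v ?n" "A *\<^sub>v v = e \<cdot>\<^sub>v v"
      using A by (auto simp: eigenvector_def)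
    obtain W c where W: "unitary_mat ?n W"
      and Wc: "\<And>i. i < ?n \<Longrightarrow> W $$ (i, 0) = c * (v $ i)"
      using unitary_with_first_col[OF v(1,2)] by metis
    have Wcar: "W \<in> carrier_mat ?n ?n" and WW: "adj W * W = 1\<^sub>m ?n" "W * adj W = 1\<^sub>m ?n"
      using W by (auto simp: unitary_mat_def)
    define B where "B = adj W * A * W"
    have hB: "hermitian ?n B"
      unfolding B_def by (rule hermitian_congruence[OF Suc.prems Wcar])
    have B: "B \<in> carrier_mat ?n ?n" using hB by (rule hermitian_carrier)
    have AW: "(A * W) $$ (i, 0) = e * W $$ (i, 0)" if "i < ?n" for i
    proof -
      have "(A * W) $$ (i, 0) = (\<Sum>l<?n. A $$ (i, l) * W $$ (l, 0))"
        by (rule index_mult_sum[OF A Wcar]) (use that in auto)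
      also have "\<dots> = c * (\<Sum>l<?n. A $$ (i, l) * (v $ l))"
        by (simp only: sum_distrib_left) (rule sum.cong, auto simp: Wc)
      also have "(\<Sum>l<?n. A $$ (i, l) * (v $ l)) = (A *\<^sub>v v) $ i"
        using A v(1) that by (simp add: scalar_prod_def atLeast0LessThan del: sum.lessThan_Suc)
      also have "\<dots> = e * (v $ i)" using v that by simp
      finally show ?thesis using Wc that by simp
    qed
    \<comment> \<open>\<open>A\<close> acts on the first column of \<open>W\<close> as the scalar
      \<open>e\<close>, and \<open>W\<close> is unitary, so the first column of \<open>B\<close> is
      \<open>e\<close> times the first unit vector. Hermiticity of \<open>B\<close> then clears the
      first row as well.\<close>
    have B0: "B $$ (i, 0) = (if i = 0 then e else 0)" if "i < ?n" for i
    proof -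
      have "B $$ (i, 0) = (adj W * (A * W)) $$ (i, 0)"
        using A Wcar by (simp add: B_def square_assoc[of _ ?n] square_adj_mult[of _ ?n])
      also have "\<dots> = (\<Sum>l<?n. adj W $$ (i, l) * (A * W) $$ (l, 0))"
        by (rule index_mult_sum[of _ ?n ?n _ ?n]) (use A Wcar that in auto)
      also have "\<dots> = e * (\<Sum>l<?n. adj W $$ (i, l) * W $$ (l, 0))"
        by (simp only: sum_distrib_left) (rule sum.cong, auto simp: AW simp del: index_adj)
      also have "(\<Sum>l<?n. adj W $$ (i, l) * W $$ (l, 0)) = (adj W * W) $$ (i, 0)"
        by (rule index_mult_sum[of _ ?n ?n _ ?n, symmetric]) (use Wcar that in auto)
      finally show ?thesis using WW that by simp
    qed
    have cB: "B $$ (i, j) = cnj (B $$ (j, i))" if "i < ?n" "j < ?n" for i j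
      using hermitian_adj[OF hB] index_adj[of i B j] B that by (metis carrier_matD)
    \<comment> \<open>The eigenvalue is a diagonal entry of a Hermitian matrix, hence real.\<close>
    have ce: "cnj e = e"
    proof -
      have "B $$ (0, 0) = e" using B0[of 0] by simp
      moreover have "B $$ (0, 0) = cnj (B $$ (0, 0))" by (rule cB) simp_all
      ultimately show ?thesis by metis
    qed
    then have er: "complex_of_real (Re e) = e" by (simp add: complex_eq_iff)
    define B' where "B' = Matrix.mat m m (\<lambda>(i, j). B $$ (Suc i, Suc j))"
    have "hermitian m B'"
      unfolding hermitian_def
    proof
      show "B' \<in> carrier_mat m m" by (simp add: B'_def)
      show "adj B' = B'"
        by (rule eq_matI) (auto simp: B'_def intro!: cB[symmetric])
    qed
    from Suc.IH[OF this] obtain V d where V: "unitary_mat m V"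
      and B'V: "B' = V * mat_diag m (\<lambda>i. complex_of_real (d i)) * adj V" by blast
    have Vcar: "V \<in> carrier_mat m m" and VV: "adj V * V = 1\<^sub>m m"
      using V by (auto simp: unitary_mat_def)
    define V1 where "V1 = four_block_mat (1\<^sub>m 1) (0\<^sub>m 1 m) (0\<^sub>m m 1) V"
    define d' where "d' = case_nat (Re e) d"
    let ?D = "mat_diag ?n (\<lambda>i. complex_of_real (d' i))"
    let ?D' = "mat_diag m (\<lambda>i. complex_of_real (d i))"
    have adjV1: "adj V1 = four_block_mat (1\<^sub>m 1) (0\<^sub>m 1 m) (0\<^sub>m m 1) (adj V)"
      by (rule eq_matI) (use Vcar in \<open>auto simp: V1_def\<close>)
    have V1car: "V1 \<in> carrier_mat ?n ?n" 
      using four_block_carrier_mat[of "1\<^sub>m 1" 1 1 V m m] Vcar by (simp add: V1_def)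
    have one1: "X * 1\<^sub>m 1 = X" "1\<^sub>m 1 * X = X" if "X \<in> carrier_mat 1 1" for X :: "complex mat"
      using that by auto
    have "adj V1 * V1 = 1\<^sub>m ?n"
      unfolding adjV1 unfolding V1_def using Vcar VV by (simp add: block_diag_mult)
    then have V1: "unitary_mat ?n V1" by (intro unitary_matI V1car)
    have Dblock: "?D = four_block_mat (mat_diag 1 (\<lambda>i. e)) (0\<^sub>m 1 m) (0\<^sub>m m 1) ?D'"
      by (rule eq_matI) (use er in \<open>auto simp: mat_diag_def d'_def split: nat.splits\<close>)
    have "V1 * ?D * adj V1 = four_block_mat (mat_diag 1 (\<lambda>i. e)) (0\<^sub>m 1 m) (0\<^sub>m m 1) (V * ?D' * adj V)"
      unfolding Dblock adjV1 unfolding V1_def using Vcar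
      by (simp only: block_diag_mult one1 one_carrier_mat mat_diag_dim adj_carrier square_mult_carrier)
    also have "\<dots> = B"
      unfolding B'V[symmetric]
    proof (rule eq_matI)
      fix i j assume "i < dim_row B" "j < dim_col B"
      then have ij: "i < ?n" "j < ?n" using B by auto
      have "B $$ (0, j) = cnj (B $$ (j, 0))" by (rule cB) (use ij in simp_all)
      then have B0': "B $$ (0, j) = (if j = 0 then e else 0)"
        unfolding B0[OF ij(2)] using ce by simp
      show "four_block_mat (mat_diag 1 (\<lambda>i. e)) (0\<^sub>m 1 m) (0\<^sub>m m 1) B' $$ (i, j) = B $$ (i, j)"
        using ij B0[OF ij(1)] B0' by (auto simp: B'_def mat_diag_def)
    qed (use B in \<open>auto simp: B'_def mat_diag_def\<close>)
    finally have BV: "B = V1 * ?D * adj V1" by simp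
    have "A = (W * adj W) * A * (W * adj W)" using A WW by simp
    also have "\<dots> = W * B * adj W"
      using A Wcar by (simp add: B_def square_assoc[of _ ?n] square_adj_mult[of _ ?n])
    also have "\<dots> = (W * V1) * ?D * adj (W * V1)"
      using Wcar V1car by (simp add: BV square_assoc[of _ ?n] square_adj_mult[of _ ?n])
    finally show ?case
      using unitary_mat_mult[OF W V1] by blast
  qed
  then show ?thesis using that by blast
qed

section \<open>Traces and positive semidefinite matrices\<close>

lemma mtrace_comm:
  assumes "A \<in> carrier_mat n n" "B \<in> carrier_mat n n"
  shows "mtrace (A * B) = mtrace (B * A)"
proof -
  have "mtrace (A * B) = (\<Sum>i<n. \<Sum>l<n. A $$ (i, l) * B $$ (l, i))"
    using assms by (simp add: mtrace_def index_mult_sum[of _ n n _ n])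
  also have "\<dots> = (\<Sum>l<n. \<Sum>i<n. B $$ (l, i) * A $$ (i, l))"
    by (subst sum.swap) (simp add: mult.commute)
  also have "\<dots> = mtrace (B * A)"
    using assms by (simp add: mtrace_def index_mult_sum[of _ n n _ n])
  finally show ?thesis .
qed

lemma mtrace_add:
  "A \<in> carrier_mat n n \<Longrightarrow> B \<in> carrier_mat n n \<Longrightarrow> mtrace (A + B) = mtrace A + mtrace B"
  by (auto simp: mtrace_def sum.distrib)

lemma mtrace_minus:
  "A \<in> carrier_mat n n \<Longrightarrow> B \<in> carrier_mat n n \<Longrightarrow> mtrace (A - B) = mtrace A - mtrace B"
  by (auto simp: mtrace_def sum_subtractf)

lemma mtrace_smult: "A \<in> carrier_mat n n \<Longrightarrow> mtrace (c \<cdot>\<^sub>m A) = c * mtrace A"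
  by (auto simp: mtrace_def sum_distrib_left)

lemma mtrace_adj: "A \<in> carrier_mat n n \<Longrightarrow> mtrace (adj A) = cnj (mtrace A)"
  by (auto simp: mtrace_def)

lemma mtrace_diag_mult:
  "P \<in> carrier_mat n n \<Longrightarrow> mtrace (mat_diag n f * P) = (\<Sum>k<n. f k * P $$ (k, k))"
  by (simp add: mtrace_def mat_diag_mult_left[of _ n n])

text \<open>By cyclicity the trace only sees the diagonal of \<open>P\<close> in the eigenbasis. The
  trace inequalities below are read off from this sum.\<close>

lemma mtrace_unitary_diag_mult:
  assumes "unitary_mat n U" "P \<in> carrier_mat n n"
  shows "mtrace (U * mat_diag n f * adj U * P) = (\<Sum>k<n. f k * (adj U * P * U) $$ (k, k))"
proof -
  have U: "U \<in> carrier_mat n n" using assms by (simp add: unitary_mat_def)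
  have "U * mat_diag n f * adj U * P = U * (mat_diag n f * (adj U * P))"
    using U assms by (simp add: square_assoc[of _ n])
  then have "mtrace (U * mat_diag n f * adj U * P) = mtrace (mat_diag n f * (adj U * P) * U)"
    using U assms by (simp add: mtrace_comm[of U n])
  also have "mat_diag n f * (adj U * P) * U = mat_diag n f * (adj U * P * U)"
    using U assms by (simp add: square_assoc[of _ n])
  finally show ?thesis using U assms by (simp add: mtrace_diag_mult)
qed

lemma diag_congruence_qform:
  assumes "P \<in> carrier_mat n n" "V \<in> carrier_mat n n" "k < n"
  shows "(adj V * P * V) $$ (k, k) = qform n P (col V k)"
proof -
  have "(adj V * P * V) $$ (k, k) = (\<Sum>j<n. (\<Sum>i<n. cnj (V $$ (i, k)) * P $$ (i, j)) * V $$ (j, k))"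
    using assms by (simp add: index_mult_sum[of _ n n _ n])
  also have "\<dots> = (\<Sum>i<n. \<Sum>j<n. cnj (V $$ (i, k)) * P $$ (i, j) * V $$ (j, k))"
    by (subst sum.swap) (simp add: sum_distrib_right)
  also have "\<dots> = qform n P (col V k)"
    using assms by (simp add: qform_def)
  finally show ?thesis .
qed

text \<open>Replacing the quadratic form by diagonal entries of congruences lets positivity be
  handled by matrix associativity alone. For the way back, a vector is packed into a matrix all of
  whose columns equal it.\<close>

lemma psd_iff:
  "psd n P \<longleftrightarrow> hermitian n P \<and> (\<forall>V\<in>carrier_mat n n. \<forall>k<n. 0 \<le> Re ((adj V * P * V) $$ (k, k)))"
  (is "?l \<longleftrightarrow> ?r")
proof
  assume l: ?l
  show ?r
  proof (intro conjI ballI allI impI)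
    show h: "hermitian n P" using l by (simp add: psd_def)
    fix V :: "complex mat" and k assume V: "V \<in> carrier_mat n n" "k < n"
    then have "col V k \<in> carrier_vec n" by auto
    then show "0 \<le> Re ((adj V * P * V) $$ (k, k))"
      using l diag_congruence_qform[OF hermitian_carrier[OF h] V] by (simp add: psd_def)
  qed
next
  assume r: ?r
  then have h: "hermitian n P" by simp
  show ?l unfolding psd_def
  proof (intro conjI h ballI)
    fix v :: "complex Matrix.vec" assume v: "v \<in> carrier_vec n"
    show "0 \<le> Re (qform n P v)"
    proof (cases "n = 0")
      case False
      define V where "V = Matrix.mat n n (\<lambda>(i, j). vec_index v i)"
      have V: "V \<in> carrier_mat n n" by (simp add: V_def)
      have "col V 0 = v" using v False by (intro eq_vecI) (auto simp: V_def)
      moreover have "0 \<le> Re ((adj V * P * V) $$ (0, 0))" using r V False by blast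
      ultimately show ?thesis
        using diag_congruence_qform[OF hermitian_carrier[OF h] V, of 0] False by simp
    qed (simp add: qform_def)
  qed
qed

lemma psd_carrier: "psd n A \<Longrightarrow> A \<in> carrier_mat n n"
  by (simp add: psd_def hermitian_def)

lemma psd_congruence:
  assumes "psd n P" "X \<in> carrier_mat n n"
  shows "psd n (adj X * P * X)"
  unfolding psd_iff
proof (intro conjI ballI allI impI)
  have P: "P \<in> carrier_mat n n" using assms by (simp add: psd_carrier)
  show "hermitian n (adj X * P * X)"
    using assms by (intro hermitian_congruence) (auto simp: psd_def)
  fix V :: "complex mat" and k assume V: "V \<in> carrier_mat n n" "k < n"
  have "adj V * (adj X * P * X) * V = adj (X * V) * P * (X * V)"
    using assms V P by (simp add: square_assoc[of _ n] square_adj_mult[of _ n])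
  then show "0 \<le> Re ((adj V * (adj X * P * X) * V) $$ (k, k))"
    using assms V unfolding psd_iff by simp
qed

lemma psd_one: "psd n (1\<^sub>m n)"
  unfolding psd_iff
proof (intro conjI ballI allI impI)
  show "hermitian n (1\<^sub>m n)" by (simp add: hermitian_def)
  fix V :: "complex mat" and k assume V: "V \<in> carrier_mat n n" "k < n"
  then have "(adj V * 1\<^sub>m n * V) $$ (k, k) = (\<Sum>l<n. cnj (V $$ (l, k)) * V $$ (l, k))"
    by (simp add: index_mult_sum[of _ n n _ n] right_mult_one_mat[of _ n n])
  then show "0 \<le> Re ((adj V * 1\<^sub>m n * V) $$ (k, k))"
    by (simp add: sum_nonneg)
qed

lemma psd_gram: "X \<in> carrier_mat n n \<Longrightarrow> psd n (adj X * X)"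
  using psd_congruence[OF psd_one, of X n] by (simp add: right_mult_one_mat[of _ n n])

lemma unitary_congruence_cancel:
  assumes "unitary_mat n U" "A = U * B * adj U" "B \<in> carrier_mat n n"
  shows "adj U * A * U = B"
proof -
  have U: "U \<in> carrier_mat n n" "adj U * U = 1\<^sub>m n" using assms by (auto simp: unitary_mat_def)
  have "adj U * A * U = (adj U * U) * B * (adj U * U)"
    using U(1) assms by (simp add: square_assoc[of _ n])
  then show ?thesis using U assms by simp
qed

lemma psd_diagonalization:
  assumes "psd n A"
  obtains U d where "unitary_mat n U" "\<And>k. k < n \<Longrightarrow> 0 \<le> d k"
    "A = U * mat_diag n (\<lambda>i. complex_of_real (d i)) * adj U"
proof -
  from assms have "hermitian n A" by (simp add: psd_def)
  then obtain U d where U: "unitary_mat n U"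
    and A: "A = U * mat_diag n (\<lambda>i. complex_of_real (d i)) * adj U"
    by (rule hermitian_diagonalization)
  have "0 \<le> d k" if "k < n" for k
  proof -
    have "0 \<le> Re ((adj U * A * U) $$ (k, k))"
      using assms U that unfolding psd_iff unitary_mat_def by blast
    then show ?thesis
      using that unfolding unitary_congruence_cancel[OF U A mat_diag_dim] by (simp add: mat_diag_def)
  qed
  then show ?thesis using that U A by blast
qed

lemma posdef_diagonalization:
  assumes "posdef n A"
  obtains U d where "unitary_mat n U" "\<And>k. k < n \<Longrightarrow> 0 < d k"
    "A = U * mat_diag n (\<lambda>i. complex_of_real (d i)) * adj U"
proof -
  from assms have h: "hermitian n A" by (simp add: posdef_def)
  then obtain U d where U: "unitary_mat n U"
    and A: "A = U * mat_diag n (\<lambda>i. complex_of_real (d i)) * adj U"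
    by (rule hermitian_diagonalization)
  have Uc: "U \<in> carrier_mat n n" and UU: "adj U * U = 1\<^sub>m n" using U by (auto simp: unitary_mat_def)
  have "0 < d k" if "k < n" for k
  proof -
    have "col U k \<noteq> 0\<^sub>v n"
    proof
      assume z: "col U k = 0\<^sub>v n"
      have "U $$ (l, k) = 0" if l: "l < n" for l
        using z l \<open>k < n\<close> Uc by (metis carrier_matD index_col index_zero_vec(1))
      then have "(adj U * U) $$ (k, k) = 0"
        using Uc that by (simp add: index_mult_sum[of _ n n _ n])
      then show False using UU that by simp
    qed
    then have "0 < Re ((adj U * A * U) $$ (k, k))"
      using assms that Uc diag_congruence_qform[OF hermitian_carrier[OF h] Uc that]
      by (auto simp: posdef_def)
    then show ?thesis
      using that unfolding unitary_congruence_cancel[OF U A mat_diag_dim] by (simp add: mat_diag_def)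
  qed
  then show ?thesis using that U A by blast
qed

text \<open>Only \<open>A\<close> is diagonalized: the trace is a sum of eigenvalues of
  \<open>A\<close> times diagonal entries of a congruence of \<open>P\<close>, all of them
  nonnegative.\<close>

lemma mtrace_psd_mult_nonneg:
  assumes "psd n A" "psd n P"
  shows "0 \<le> Re (mtrace (A * P))"
proof -
  obtain U d where U: "unitary_mat n U" "\<And>k. k < n \<Longrightarrow> 0 \<le> d k"
    and A: "A = U * mat_diag n (\<lambda>i. complex_of_real (d i)) * adj U"
    using psd_diagonalization[OF assms(1)] by metis
  have "0 \<le> Re ((adj U * P * U) $$ (k, k))" if "k < n" for k
    using assms(2) U(1) that unfolding psd_iff unitary_mat_def by blast
  then show ?thesis
    using U unfolding A mtrace_unitary_diag_mult[OF U(1) psd_carrier[OF assms(2)]]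
    by (auto intro!: sum_nonneg mult_nonneg_nonneg)
qed

lemma mtrace_unitary_congruence:
  assumes "unitary_mat n U" "P \<in> carrier_mat n n"
  shows "mtrace (adj U * P * U) = mtrace P"
proof -
  have U: "U \<in> carrier_mat n n" "U * adj U = 1\<^sub>m n" using assms by (auto simp: unitary_mat_def)
  have "mtrace (adj U * P * U) = mtrace (U * (adj U * P))"
    using U assms by (simp add: mtrace_comm[of _ n U])
  also have "U * (adj U * P) = U * adj U * P"
    using U(1) assms by (simp add: square_assoc[of _ n])
  finally show ?thesis using U assms by simp
qed

text \<open>The operator inequality \<open>A >= c I\<close> in the form used later: smallness of a
  trace against the state forces smallness of the trace itself.\<close>

lemma posdef_trace_bound:
  assumes "posdef n A"
  obtains c where "0 < c" "\<And>P. psd n P \<Longrightarrow> c * Re (mtrace P) \<le> Re (mtrace (A * P))"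
proof -
  obtain U d where U: "unitary_mat n U" "\<And>k. k < n \<Longrightarrow> 0 < d k"
    and A: "A = U * mat_diag n (\<lambda>i. complex_of_real (d i)) * adj U"
    using posdef_diagonalization[OF assms(1)] by metis
  \<comment> \<open>The smallest eigenvalue, capped at 1; the inserted 1 keeps the set nonempty when
    \<open>n = 0\<close>.\<close>
  define c where "c = Min (insert 1 (d ` {..<n}))"
  have c0: "0 < c" unfolding c_def using U(2) by (subst Min_gr_iff) auto
  have cd: "c \<le> d k" if "k < n" for k unfolding c_def using that by (intro Min_le) auto
  have "c * Re (mtrace P) \<le> Re (mtrace (A * P))" if P: "psd n P" for P
  proof -
    have "c * Re (mtrace P) = (\<Sum>k<n. c * Re ((adj U * P * U) $$ (k, k)))"
      unfolding mtrace_unitary_congruence[OF U(1) psd_carrier[OF P], symmetric]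
      using U(1) by (auto simp: mtrace_def unitary_mat_def sum_distrib_left)
    also have "\<dots> \<le> (\<Sum>k<n. d k * Re ((adj U * P * U) $$ (k, k)))"
    proof (rule sum_mono)
      fix k assume "k \<in> {..<n}"
      then show "c * Re ((adj U * P * U) $$ (k, k)) \<le> d k * Re ((adj U * P * U) $$ (k, k))"
        using P U(1) cd unfolding psd_iff unitary_mat_def by (intro mult_right_mono) blast+
    qed
    also have "\<dots> = Re (mtrace (A * P))"
      unfolding A mtrace_unitary_diag_mult[OF U(1) psd_carrier[OF P]] by simp
    finally show ?thesis .
  qed
  with c0 show ?thesis using that by blast
qed

text \<open>In terms of the spectral decomposition the diagonal entry is a sum of nonnegative terms
  \<open>d l * |U_kl|^2\<close>. If it vanishes, so does each \<open>d l * U_kl\<close>, and this is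
  a factor of every summand in row \<open>k\<close>.\<close>

lemma psd_zero_diag:
  assumes P: "psd n P" and k: "k < n" "j < n" and z: "P $$ (k, k) = 0"
  shows "P $$ (k, j) = 0"
proof -
  obtain U d where U: "unitary_mat n U" "\<And>k. k < n \<Longrightarrow> 0 \<le> d k"
    and A: "P = U * mat_diag n (\<lambda>i. complex_of_real (d i)) * adj U"
    using psd_diagonalization[OF P] by metis
  have Uc: "U \<in> carrier_mat n n" using U by (simp add: unitary_mat_def)
  have e: "P $$ (a, b) = (\<Sum>l<n. U $$ (a, l) * complex_of_real (d l) * cnj (U $$ (b, l)))"
    if "a < n" "b < n" for a b
    unfolding A using that Uc
    by (simp add: mat_diag_mult_right[of _ n n] index_mult_sum[of _ n n _ n])
  have "P $$ (k, k) = complex_of_real (\<Sum>l<n. d l * (cmod (U $$ (k, l)))\<^sup>2)"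
    unfolding e[OF k(1) k(1)] of_real_sum
    by (rule sum.cong) (auto simp: complex_norm_square simp del: of_real_power)
  then have "(\<Sum>l<n. d l * (cmod (U $$ (k, l)))\<^sup>2) = 0" using z by (metis of_real_eq_0_iff)
  then have "d l * (cmod (U $$ (k, l)))\<^sup>2 = 0" if "l < n" for l
    using that U(2) by (subst (asm) sum_nonneg_eq_0_iff) auto
  then show ?thesis unfolding e[OF k] by (intro sum.neutral) auto
qed

lemma unitary_congruence_inj:
  assumes "unitary_mat n U" "A \<in> carrier_mat n n" "B \<in> carrier_mat n n"
  shows "adj U * A * U = B \<longleftrightarrow> A = U * B * adj U"
proof
  have U: "U \<in> carrier_mat n n" "U * adj U = 1\<^sub>m n" using assms by (auto simp: unitary_mat_def)
  assume "adj U * A * U = B"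
  then have "U * B * adj U = U * (adj U * A * U) * adj U" by simp
  also have "\<dots> = (U * adj U) * A * (U * adj U)" using U(1) assms by (simp add: square_assoc[of _ n])
  finally show "A = U * B * adj U" using U assms by simp
qed (use unitary_congruence_cancel assms in blast)

section \<open>Logarithmic derivatives and the Moore--Penrose inverse\<close>

text \<open>In an eigenbasis of \<open>R\<close> the equation decouples into the scalar equations
  \<open>F_ij = (p_i + p_j) Y_ij / 2\<close>, each uniquely solvable because
  \<open>p_i + p_j > 0\<close>.\<close>

lemma sld_ex1:
  assumes R: "posdef n R" and D: "hermitian n D"
  shows "\<exists>!L. hermitian n L \<and> D = (1/2 :: complex) \<cdot>\<^sub>m (R * L + L * R)"
proof -
  obtain U p where U: "unitary_mat n U" "\<And>k. k < n \<Longrightarrow> 0 < p k"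
    and A: "R = U * mat_diag n (\<lambda>i. complex_of_real (p i)) * adj U"
    using posdef_diagonalization[OF R] by metis
  have Uc: "U \<in> carrier_mat n n" "adj U * U = 1\<^sub>m n" "U * adj U = 1\<^sub>m n"
    using U by (auto simp: unitary_mat_def)
  have Dc: "D \<in> carrier_mat n n" using D by (rule hermitian_carrier)
  define F where "F = adj U * D * U"
  let ?P = "mat_diag n (\<lambda>i. complex_of_real (p i))"
  have F: "hermitian n F" unfolding F_def by (rule hermitian_congruence[OF D Uc(1)])
  have Fc: "F \<in> carrier_mat n n" using F by (rule hermitian_carrier)
  \<comment> \<open>The entrywise solution in the eigenbasis. It inherits hermiticity from
    \<open>F\<close> because \<open>p i + p j\<close> is real and symmetric in \<open>i\<close> and
    \<open>j\<close>.\<close>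
  define S where "S = Matrix.mat n n (\<lambda>(i, j). 2 * F $$ (i, j) / complex_of_real (p i + p j))"
  have Sc: "S \<in> carrier_mat n n" by (simp add: S_def)
  have Fij: "F $$ (i, j) = cnj (F $$ (j, i))" if "i < n" "j < n" for i j
    using hermitian_adj[OF F] index_adj[of i F j] Fc that by (metis carrier_matD)
  have "adj S = S" by (rule eq_matI) (auto simp: S_def add.commute intro: Fij[symmetric])
  then have "hermitian n S" using Sc by (simp add: hermitian_def)
  from hermitian_congruence[OF this, of "adj U"] Uc
  have h: "hermitian n (U * S * adj U)" by simp
  \<comment> \<open>An equivalence, so that one computation yields both existence and
    uniqueness.\<close>
  have key: "D = (1/2 :: complex) \<cdot>\<^sub>m (R * L + L * R) \<longleftrightarrow> L = U * S * adj U"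
    if L: "L \<in> carrier_mat n n" for L
  proof -
    define Y where "Y = adj U * L * U"
    have Y: "Y \<in> carrier_mat n n" using L Uc by (simp add: Y_def)
    have LY: "L = U * Y * adj U"
      using unitary_congruence_inj[OF U(1) L Y] by (simp add: Y_def)
    have "R * L = (U * ?P) * (adj U * U) * (Y * adj U)"
      using Uc(1) Y by (simp only: LY A square_assoc[of _ n] square_mult_carrier adj_carrier mat_diag_dim)
    then have 1: "R * L = U * (?P * Y) * adj U"
      using Uc(1) Y by (simp add: Uc(2) right_mult_one_mat[of _ n n] square_assoc[of _ n])
    have "L * R = (U * Y) * (adj U * U) * (?P * adj U)"
      using Uc(1) Y by (simp only: LY A square_assoc[of _ n] square_mult_carrier adj_carrier mat_diag_dim)
    then have 2: "L * R = U * (Y * ?P) * adj U"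
      using Uc(1) Y by (simp add: Uc(2) right_mult_one_mat[of _ n n] square_assoc[of _ n])
    have "(1/2 :: complex) \<cdot>\<^sub>m (R * L + L * R) = U * ((1/2 :: complex) \<cdot>\<^sub>m (?P * Y + Y * ?P)) * adj U"
      unfolding 1 2 using Uc(1) Y
      by (simp add: mult_add_distrib_mat[of _ n n _ n] add_mult_distrib_mat[of _ n n _ _ n]
          mult_smult_distrib[of _ n n _ n] mult_smult_assoc_mat[of _ n n _ n])
    then have "D = (1/2 :: complex) \<cdot>\<^sub>m (R * L + L * R)
        \<longleftrightarrow> F = (1/2 :: complex) \<cdot>\<^sub>m (?P * Y + Y * ?P)"
      unfolding F_def using unitary_congruence_inj[OF U(1) Dc] Y by simp
    also have "\<dots> \<longleftrightarrow> (\<forall>i<n. \<forall>j<n. F $$ (i, j) = (complex_of_real (p i) + complex_of_real (p j)) * Y $$ (i, j) / 2)"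
    proof -
      define E where "E = (1/2 :: complex) \<cdot>\<^sub>m (?P * Y + Y * ?P)"
      have "E $$ (i, j) = (complex_of_real (p i) + complex_of_real (p j)) * Y $$ (i, j) / 2"
        if "i < n" "j < n" for i j
        using that Y
        by (simp add: E_def mat_diag_mult_left[of _ n n] mat_diag_mult_right[of _ n n] distrib_right)
      moreover have "E \<in> carrier_mat n n" using Y by (simp add: E_def)
      then have "F = E \<longleftrightarrow> (\<forall>i<n. \<forall>j<n. F $$ (i, j) = E $$ (i, j))"
        using Fc by (auto simp: mat_eq_iff)
      ultimately show ?thesis unfolding E_def[symmetric] by metis
    qed
    also have "\<dots> \<longleftrightarrow> (\<forall>i<n. \<forall>j<n. Y $$ (i, j) = S $$ (i, j))"
    proof -
      have "F $$ (i, j) = (complex_of_real (p i) + complex_of_real (p j)) * Y $$ (i, j) / 2 \<longleftrightarrow> Y $$ (i, j) = S $$ (i, j)"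
        if "i < n" "j < n" for i j
      proof -
        have "complex_of_real (p i) + complex_of_real (p j) \<noteq> 0"
          using U(2)[OF that(1)] U(2)[OF that(2)] by (metis add_pos_pos less_irrefl of_real_add of_real_eq_0_iff)
        then show ?thesis using that by (auto simp: S_def field_simps)
      qed
      then show ?thesis by blast
    qed
    also have "\<dots> \<longleftrightarrow> Y = S" using Y Sc by (auto simp: mat_eq_iff)
    also have "\<dots> \<longleftrightarrow> L = U * S * adj U"
      using unitary_congruence_inj[OF U(1) L Sc] by (simp add: Y_def)
    finally show ?thesis .
  qed
  show ?thesis
    using h key hermitian_carrier by (intro ex1I[of _ "U * S * adj U"]) blast+
qed

lemma unitary_diag_mult:
  assumes "unitary_mat n U"
  shows "(U * mat_diag n f * adj U) * (U * mat_diag n g * adj U) = U * mat_diag n (\<lambda>i. f i * g i) * adj U"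
proof -
  have Uc: "U \<in> carrier_mat n n" "adj U * U = 1\<^sub>m n"
    using assms by (auto simp: unitary_mat_def)
  have "(U * mat_diag n f * adj U) * (U * mat_diag n g * adj U)
      = U * mat_diag n f * (adj U * U) * (mat_diag n g * adj U)"
    using Uc(1) by (simp add: square_assoc[of _ n])
  also have "\<dots> = U * (mat_diag n f * mat_diag n g) * adj U"
    unfolding Uc(2) using Uc(1) by (simp add: right_mult_one_mat[of _ n n] square_assoc[of _ n] del: mat_diag_diag)
  finally show ?thesis by simp
qed

text \<open>Inverting the eigenvalues of \<open>R\<close> gives a two-sided inverse
  \<open>S\<close>, so \<open>S * D\<close> is the only solution.\<close>

lemma rld_ex1:
  assumes R: "posdef n R" and D: "D \<in> carrier_mat n n"
  shows "\<exists>!L. L \<in> carrier_mat n n \<and> D = R * L"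
proof -
  obtain U p where U: "unitary_mat n U" "\<And>k. k < n \<Longrightarrow> 0 < p k"
    and A: "R = U * mat_diag n (\<lambda>i. complex_of_real (p i)) * adj U"
    using posdef_diagonalization[OF R] by metis
  have Uc: "U \<in> carrier_mat n n" "U * adj U = 1\<^sub>m n"
    using U by (auto simp: unitary_mat_def)
  define S where "S = U * mat_diag n (\<lambda>i. inverse (complex_of_real (p i))) * adj U"
  have Sc: "S \<in> carrier_mat n n" "R \<in> carrier_mat n n" using Uc by (auto simp: S_def A)
  have "mat_diag n (\<lambda>i. complex_of_real (p i) * inverse (complex_of_real (p i))) = 1\<^sub>m n"
    using U(2) by (intro eq_matI) (force simp: mat_diag_def)+
  then have RS: "R * S = 1\<^sub>m n"
    unfolding A S_def unitary_diag_mult[OF U(1)] using Uc by simp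
  then have SR: "S * R = 1\<^sub>m n" using mat_mult_left_right_inverse Sc by blast
  show ?thesis
  proof (intro ex1I[of _ "S * D"] conjI)
    show "D = R * (S * D)" using RS Sc D by (simp flip: square_assoc[of _ n])
    fix L assume L: "L \<in> carrier_mat n n \<and> D = R * L"
    then have "S * D = (S * R) * L" using Sc by (simp add: square_assoc[of _ n])
    then show "L = S * D" using SR L left_mult_one_mat[of L n n] by simp
  qed (use Sc D in simp)
qed

section \<open>The Moore-Penrose inverse\<close>

definition is_mp_inverse :: "complex mat \<Rightarrow> complex mat \<Rightarrow> bool" where
  "is_mp_inverse A X \<longleftrightarrow> X \<in> carrier_mat (dim_col A) (dim_row A) \<and>
      A * X * A = A \<and> X * A * X = X \<and> adj (A * X) = A * X \<and> adj (X * A) = X * A"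

text \<open>Penrose's argument: \<open>A * X\<close> and \<open>A * Y\<close> are Hermitian and
  absorb one another, hence coincide; likewise \<open>X * A\<close> and \<open>Y * A\<close>. Then
  \<open>X = X A X = X A Y = Y A Y = Y\<close>.\<close>

lemma is_mp_inverse_unique:
  assumes A: "A \<in> carrier_mat n n" and X: "is_mp_inverse A X" and Y: "is_mp_inverse A Y"
  shows "X = Y"
proof -
  have c: "X \<in> carrier_mat n n" "Y \<in> carrier_mat n n" using assms by (auto simp: is_mp_inverse_def)
  have cancel: "A * Y * (A * X) = A * X" "X * A * (Y * A) = X * A"
    if X: "is_mp_inverse A X" "X \<in> carrier_mat n n"
      and Y: "is_mp_inverse A Y" "Y \<in> carrier_mat n n" for X Y
  proof -
    have "A * Y * (A * X) = A * Y * A * X" using A X(2) Y(2) by (simp add: square_assoc[of _ n])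
    then show "A * Y * (A * X) = A * X" using Y(1) by (simp add: is_mp_inverse_def)
    have "X * A * (Y * A) = X * (A * Y * A)" using A X(2) Y(2) by (simp add: square_assoc[of _ n])
    then show "X * A * (Y * A) = X * A" using Y(1) by (simp add: is_mp_inverse_def)
  qed
  have h: "adj (A * Z) = A * Z" "adj (Z * A) = Z * A" "Z * A * Z = Z" if "is_mp_inverse A Z" for Z
    using that by (simp_all add: is_mp_inverse_def)
  have AXc: "A * X \<in> carrier_mat n n" "A * Y \<in> carrier_mat n n"
    "X * A \<in> carrier_mat n n" "Y * A \<in> carrier_mat n n"
    using A c by simp_all
  have "A * X = adj (A * Y * (A * X))" unfolding cancel[OF X c(1) Y c(2)] h(1)[OF X] ..
  also have "\<dots> = A * X * (A * Y)"
    unfolding square_adj_mult[OF AXc(2,1)] h(1)[OF X] h(1)[OF Y] ..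
  also have "\<dots> = A * Y" by (rule cancel[OF Y c(2) X c(1)])
  finally have 1: "A * X = A * Y" .
  have "X * A = adj (X * A * (Y * A))" unfolding cancel[OF X c(1) Y c(2)] h(2)[OF X] ..
  also have "\<dots> = Y * A * (X * A)"
    unfolding square_adj_mult[OF AXc(3,4)] h(2)[OF X] h(2)[OF Y] ..
  also have "\<dots> = Y * A" by (rule cancel[OF Y c(2) X c(1)])
  finally have 2: "X * A = Y * A" .
  have "X = X * (A * X)" using h(3)[OF X] unfolding square_assoc[OF c(1) A c(1)] by (rule sym)
  also have "\<dots> = X * A * Y" unfolding 1 by (rule square_assoc[symmetric, OF c(1) A c(2)])
  also have "\<dots> = Y" unfolding 2 by (rule h(3)[OF Y])
  finally show ?thesis .
qed

text \<open>The eigenvalues are inverted one by one. The convention \<open>inverse 0 = 0\<close>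
  gives exactly the value on the kernel that the Penrose equations demand.\<close>

lemma is_mp_inverse_exists:
  assumes "hermitian n A"
  obtains X where "is_mp_inverse A X"
proof -
  obtain U d where U: "unitary_mat n U"
    and A: "A = U * mat_diag n (\<lambda>i. complex_of_real (d i)) * adj U"
    using hermitian_diagonalization[OF assms] by metis
  have Uc: "U \<in> carrier_mat n n" using U by (simp add: unitary_mat_def)
  have h: "adj (U * mat_diag n (\<lambda>i. complex_of_real (f i)) * adj U)
      = U * mat_diag n (\<lambda>i. complex_of_real (f i)) * adj U" for f
    using Uc by (simp add: square_assoc[of _ n] square_adj_mult[of _ n])
  have [simp]: "x * inverse x * x = x" "inverse x * x * inverse x = inverse x" for x :: real
    by (cases "x = 0"; simp)+
  have "is_mp_inverse A (U * mat_diag n (\<lambda>i. complex_of_real (inverse (d i))) * adj U)"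
    unfolding is_mp_inverse_def A unitary_diag_mult[OF U] of_real_mult[symmetric] h
    using Uc by simp
  then show ?thesis by (rule that)
qed

lemma mp_inverse_eqI:
  assumes "A \<in> carrier_mat n n" "is_mp_inverse A X"
  shows "mp_inverse A = X"
  unfolding mp_inverse_def is_mp_inverse_def[symmetric]
  using assms is_mp_inverse_unique by blast

text \<open>The adjoint of a Moore-Penrose inverse of \<open>A\<close> solves the four equations for
  \<open>adj A = A\<close>, so uniqueness identifies the two.\<close>

lemma mp_inverse_hermitian:
  assumes h: "hermitian n A"
  shows "is_mp_inverse A (mp_inverse A)" "hermitian n (mp_inverse A)"
proof -
  have A: "A \<in> carrier_mat n n" "adj A = A" using h by (auto simp: hermitian_def)
  obtain X where X: "is_mp_inverse A X" using is_mp_inverse_exists[OF h] .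
  have m: "mp_inverse A = X" by (rule mp_inverse_eqI[OF A(1) X])
  show "is_mp_inverse A (mp_inverse A)" using X m by simp
  have c: "X \<in> carrier_mat n n" using X A by (auto simp: is_mp_inverse_def)
  have x: "A * X * A = A" "X * A * X = X" "adj (A * X) = A * X" "adj (X * A) = X * A"
    using X by (auto simp: is_mp_inverse_def)
  have a: "adj X * A = A * X" "A * adj X = X * A"
    using x(3,4) A c by (simp_all add: square_adj_mult[of _ n])
  have "is_mp_inverse A (adj X)"
    unfolding is_mp_inverse_def
  proof (intro conjI)
    show "adj X \<in> carrier_mat (dim_col A) (dim_row A)" using A c by auto
    show "A * adj X * A = A" using arg_cong[OF x(1), of adj] A c
      by (simp add: square_adj_mult[of _ n] square_assoc[of _ n])
    show "adj X * A * adj X = adj X" using arg_cong[OF x(2), of adj] A c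
      by (simp add: square_adj_mult[of _ n] square_assoc[of _ n])
    show "adj (A * adj X) = A * adj X" "adj (adj X * A) = adj X * A" unfolding a using x by auto
  qed
  then have "X = adj X" by (rule is_mp_inverse_unique[OF A(1) X])
  then show "hermitian n (mp_inverse A)"
    using m c by (simp add: hermitian_def)
qed

text \<open>A Hermitian matrix with real entries is symmetric, so the transpose of its Moore-Penrose
  inverse solves the same equations. A matrix that is both symmetric and Hermitian has real
  entries.\<close>

lemma mp_inverse_real:
  assumes h: "hermitian n A" and r: "\<And>i j. i < n \<Longrightarrow> j < n \<Longrightarrow> A $$ (i, j) \<in> \<real>"
    and ij: "i < n" "j < n"
  shows "mp_inverse A $$ (i, j) \<in> \<real>"
proof -
  let ?X = "mp_inverse A"
  have A: "A \<in> carrier_mat n n" "adj A = A" using h by (auto simp: hermitian_def)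
  note X = mp_inverse_hermitian(1)[OF h]
  have c: "?X \<in> carrier_mat n n" using X A by (auto simp: is_mp_inverse_def)
  have x: "A * ?X * A = A" "?X * A * ?X = ?X" "adj (A * ?X) = A * ?X" "adj (?X * A) = ?X * A"
    using X by (auto simp: is_mp_inverse_def)
  have "adj A = A\<^sup>T"
  proof (rule eq_matI)
    fix i j assume "i < dim_row A\<^sup>T" "j < dim_col A\<^sup>T"
    then show "adj A $$ (i, j) = A\<^sup>T $$ (i, j)"
      using A(1) r[of j i] by (simp add: Reals_cnj_iff)
  qed (use A(1) in auto)
  then have t: "A\<^sup>T = A" using A by simp
  have tm: "(P * Q)\<^sup>T = Q\<^sup>T * P\<^sup>T" if "P \<in> carrier_mat n n" "Q \<in> carrier_mat n n" for P Q :: "complex mat"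
    using that by (rule transpose_mult)
  have at: "adj (P\<^sup>T) = (adj P)\<^sup>T" for P by (rule eq_matI) auto
  have a: "A * ?X\<^sup>T = (?X * A)\<^sup>T" "?X\<^sup>T * A = (A * ?X)\<^sup>T" using tm A(1) c t by simp_all
  have "is_mp_inverse A (?X\<^sup>T)"
    unfolding is_mp_inverse_def
  proof (intro conjI)
    show "?X\<^sup>T \<in> carrier_mat (dim_col A) (dim_row A)" using A c by auto
    show "A * ?X\<^sup>T * A = A" using arg_cong[OF x(1), of transpose_mat] A(1) c
      by (simp add: tm t square_assoc[of _ n])
    show "?X\<^sup>T * A * ?X\<^sup>T = ?X\<^sup>T" using arg_cong[OF x(2), of transpose_mat] A(1) c
      by (simp add: tm t square_assoc[of _ n])
    show "adj (A * ?X\<^sup>T) = A * ?X\<^sup>T" "adj (?X\<^sup>T * A) = ?X\<^sup>T * A" unfolding a at x by auto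
  qed
  then have "?X = ?X\<^sup>T" by (rule is_mp_inverse_unique[OF A(1) X])
  then have "?X $$ (i, j) = ?X $$ (j, i)" using c ij by (metis carrier_matD index_transpose_mat(1))
  moreover have "?X $$ (i, j) = cnj (?X $$ (j, i))"
    using hermitian_adj[OF mp_inverse_hermitian(2)[OF h]] index_adj[of i ?X j] c ij by (metis carrier_matD)
  ultimately show ?thesis by (simp add: Reals_cnj_iff)
qed

section \<open>Outcome distributions\<close>

lemma povm_psd: "is_povm n M \<Longrightarrow> A \<in> sets borel \<Longrightarrow> psd n (M A)"
  by (simp add: is_povm_def)

lemma povm_carrier: "is_povm n M \<Longrightarrow> A \<in> sets borel \<Longrightarrow> M A \<in> carrier_mat n n"
  by (intro psd_carrier povm_psd)

lemma povm_UNIV: "is_povm n M \<Longrightarrow> M UNIV = 1\<^sub>m n"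
  by (simp add: is_povm_def)

text \<open>The trace against a fixed \<open>\<sigma>\<close> is a finite linear combination of
  entries, so the entrywise convergence in \<open>is_povm\<close> carries over.\<close>

lemma povm_sums:
  assumes M: "is_povm n M" and F: "range F \<subseteq> sets borel" "disjoint_family F"
    and s: "\<sigma> \<in> carrier_mat n n"
  shows "(\<lambda>i. mtrace (\<sigma> * M (F i))) sums mtrace (\<sigma> * M (\<Union>i. F i))"
proof -
  have U: "(\<Union>i. F i) \<in> sets borel" using F(1) by (intro sets.countable_UN) auto
  have e: "mtrace (\<sigma> * M A) = (\<Sum>a<n. \<Sum>b<n. \<sigma> $$ (a, b) * M A $$ (b, a))" if "A \<in> sets borel" for A
    using s povm_carrier[OF M that] by (simp add: mtrace_def index_mult_sum[of _ n n _ n])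
  have Fi: "F i \<in> sets borel" for i using F(1) by auto
  have "(\<lambda>k. \<Sum>i<k. mtrace (\<sigma> * M (F i)))
      = (\<lambda>k. \<Sum>a<n. \<Sum>b<n. \<sigma> $$ (a, b) * (\<Sum>i<k. M (F i) $$ (b, a)))"
  proof
    fix k
    have "(\<Sum>i<k. mtrace (\<sigma> * M (F i))) = (\<Sum>i<k. \<Sum>a<n. \<Sum>b<n. \<sigma> $$ (a, b) * M (F i) $$ (b, a))"
      by (simp add: e Fi)
    also have "\<dots> = (\<Sum>a<n. \<Sum>b<n. \<Sum>i<k. \<sigma> $$ (a, b) * M (F i) $$ (b, a))"
      by (subst sum.swap) (simp add: sum.swap[of _ "{..<n}" "{..<k}"])
    finally show "(\<Sum>i<k. mtrace (\<sigma> * M (F i)))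
        = (\<Sum>a<n. \<Sum>b<n. \<sigma> $$ (a, b) * (\<Sum>i<k. M (F i) $$ (b, a)))"
      by (simp add: sum_distrib_left)
  qed
  moreover have "(\<lambda>k. \<Sum>a<n. \<Sum>b<n. \<sigma> $$ (a, b) * (\<Sum>i<k. M (F i) $$ (b, a)))
      \<longlonglongrightarrow> (\<Sum>a<n. \<Sum>b<n. \<sigma> $$ (a, b) * M (\<Union>i. F i) $$ (b, a))"
    using M F unfolding is_povm_def by (intro tendsto_sum tendsto_mult tendsto_const) auto
  ultimately show ?thesis unfolding sums_def e[OF U] by simp
qed

text \<open>Additivity along the constant sequence of empty sets makes a constant series converge,
  which forces its term to be 0.\<close>

lemma povm_empty:
  assumes M: "is_povm n M"
  shows "M {} = 0\<^sub>m n n"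
proof (rule eq_matI)
  fix a b assume "a < dim_row (0\<^sub>m n n :: complex mat)" "b < dim_col (0\<^sub>m n n :: complex mat)"
  then have ab: "a < n" "b < n" by auto
  have "(\<lambda>k. \<Sum>i<k. M ((\<lambda>_. {}) i) $$ (a, b)) \<longlonglongrightarrow> M (\<Union>i::nat. (\<lambda>_. {}) i) $$ (a, b)"
    using M ab unfolding is_povm_def by (auto simp: disjoint_family_on_def)
  then have "summable (\<lambda>i::nat. M {} $$ (a, b))" by (auto simp: summable_def sums_def)
  then show "M {} $$ (a, b) = 0\<^sub>m n n $$ (a, b)" using ab by (simp add: summable_const_iff)
qed (use povm_carrier[OF M, of "{}"] in auto)

lemma povm_Compl:
  assumes M: "is_povm n M" and A: "A \<in> sets borel"
  shows "M A + M (- A) = 1\<^sub>m n"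
proof (rule eq_matI)
  have A': "- A \<in> sets borel" using A by auto
  fix a b assume "a < dim_row (1\<^sub>m n :: complex mat)" "b < dim_col (1\<^sub>m n :: complex mat)"
  then have ab: "a < n" "b < n" by auto
  let ?F = "binaryset A (- A)"
  have "range ?F \<subseteq> sets borel" using A A' by (auto simp: range_binaryset_eq)
  moreover have "disjoint_family ?F" by (auto simp: disjoint_family_on_def binaryset_def)
  ultimately have "(\<lambda>i. M (?F i) $$ (a, b)) sums (M (\<Union>i. ?F i) $$ (a, b))"
    using M ab unfolding is_povm_def sums_def by blast
  moreover have "(\<lambda>i. M (?F i) $$ (a, b)) sums (M A $$ (a, b) + M (- A) $$ (a, b))"
    using binaryset_sums[of "\<lambda>B. M B $$ (a, b)"] povm_empty[OF M] ab by simp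
  ultimately have "M (\<Union>i. ?F i) $$ (a, b) = M A $$ (a, b) + M (- A) $$ (a, b)"
    by (rule sums_unique2)
  then show "(M A + M (- A)) $$ (a, b) = 1\<^sub>m n $$ (a, b)"
    using ab povm_carrier[OF M A] povm_carrier[OF M A'] povm_UNIV[OF M] by (simp add: UN_binaryset_eq)
qed (use povm_carrier[OF M, of "- A"] A in auto)

lemma sets_outcome [simp, measurable_cong]: "sets (outcome \<sigma> M) = sets borel"
  unfolding outcome_def by (subst sets_measure_of) (auto simp: sets.sigma_sets_eq[of borel, simplified])

lemma space_outcome [simp]: "space (outcome \<sigma> M) = UNIV"
  unfolding outcome_def by (rule space_measure_of) simp

lemma emeasure_outcome:
  assumes M: "is_povm n M" and s: "psd n \<sigma>" and A: "A \<in> sets borel"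
  shows "emeasure (outcome \<sigma> M) A = ennreal (Re (mtrace (\<sigma> * M A)))"
proof -
  have sc: "\<sigma> \<in> carrier_mat n n" using s by (rule psd_carrier)
  note outcome_def
  moreover have "sets (outcome \<sigma> M) = sets borel" by simp
  moreover have "positive (sets borel) (\<lambda>A. ennreal (Re (mtrace (\<sigma> * M A))))"
    using povm_empty[OF M] sc right_mult_zero_mat[of \<sigma> n n n] by (simp add: positive_def mtrace_def)
  moreover have "countably_additive (sets borel) (\<lambda>A. ennreal (Re (mtrace (\<sigma> * M A))))"
    unfolding countably_additive_def
  proof (intro allI impI)
    fix F :: "nat \<Rightarrow> real set"
    assume F: "range F \<subseteq> sets borel" "disjoint_family F"
    have "(\<lambda>i. Re (mtrace (\<sigma> * M (F i)))) sums Re (mtrace (\<sigma> * M (\<Union>i. F i)))"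
      by (rule sums_Re[OF povm_sums[OF M F sc]])
    then show "(\<Sum>i. ennreal (Re (mtrace (\<sigma> * M (F i))))) = ennreal (Re (mtrace (\<sigma> * M (\<Union>i. F i))))"
      using F(1) by (intro suminf_ennreal_eq mtrace_psd_mult_nonneg[OF s povm_psd[OF M]]) auto
  qed
  ultimately show ?thesis
    using A by (intro emeasure_measure_of[of _ UNIV "sets borel"]) auto
qed

lemma measure_outcome:
  assumes "is_povm n M" "psd n \<sigma>" "A \<in> sets borel"
  shows "measure (outcome \<sigma> M) A = Re (mtrace (\<sigma> * M A))"
  using emeasure_outcome[OF assms] mtrace_psd_mult_nonneg[OF assms(2) povm_psd[OF assms(1,3)]]
  by (simp add: measure_def)

lemma finite_measure_outcome:
  assumes "is_povm n M" "psd n \<sigma>"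
  shows "finite_measure (outcome \<sigma> M)"
  by (rule finite_measureI) (simp add: emeasure_outcome[OF assms])

lemma measure_outcome_UNIV:
  assumes "is_povm n M" "psd n \<sigma>"
  shows "measure (outcome \<sigma> M) UNIV = Re (mtrace \<sigma>)"
  using measure_outcome[OF assms, of UNIV] psd_carrier[OF assms(2)] povm_UNIV[OF assms(1)]
  by (simp add: right_mult_one_mat[of _ n n])

text \<open>Simplicity refers to \<open>borel\<close> and not to \<open>N\<close>, so one
  \<open>f\<close> can be integrated against several outcome measures, each time as a sum over the
  same finite range.\<close>

lemma integral_simple_function:
  fixes f h :: "real \<Rightarrow> real"
  assumes fin: "finite_measure N" and N: "sets N = sets borel" and f: "simple_function borel f"
  shows "integrable N (\<lambda>x. h (f x))"
    "(\<integral>x. h (f x) \<partial>N) = (\<Sum>y\<in>range f. h y * measure N (f -` {y}))"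
proof -
  interpret finite_measure N by fact
  have sp: "space N = UNIV" using sets_eq_imp_space_eq[OF N] by simp
  have R: "finite (range f)" using simple_functionD(1)[OF f] by simp
  have meas: "f -` {y} \<in> sets N" for y
    using simple_functionD(2)[OF f, of "{y}"] N by simp
  have e: "h (f x) = (\<Sum>y\<in>range f. h y * indicator (f -` {y}) x)" for x
  proof -
    have "(\<Sum>y\<in>range f. h y * indicator (f -` {y}) x) = (\<Sum>y\<in>range f. if y = f x then h y else 0)"
      by (rule sum.cong) (auto simp: indicator_def)
    also have "\<dots> = h (f x)" using R by (simp add: sum.delta)
    finally show ?thesis ..
  qed
  have i: "integrable N (\<lambda>x. h y * indicator (f -` {y}) x :: real)" for y
    using meas by (intro integrable_mult_right integrable_real_indicator) (auto simp: emeasure_finite less_top[symmetric])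
  show "integrable N (\<lambda>x. h (f x))" unfolding e by (rule Bochner_Integration.integrable_sum) (rule i)
  have "(\<integral>x. h (f x) \<partial>N) = (\<integral>x. (\<Sum>y\<in>range f. h y * indicator (f -` {y}) x) \<partial>N)"
    using e by simp
  also have "\<dots> = (\<Sum>y\<in>range f. \<integral>x. h y * indicator (f -` {y}) x \<partial>N)"
    by (rule Bochner_Integration.integral_sum) (rule i)
  also have "\<dots> = (\<Sum>y\<in>range f. h y * measure N (f -` {y}))"
    using meas sp by simp
  finally show "(\<integral>x. h (f x) \<partial>N) = (\<Sum>y\<in>range f. h y * measure N (f -` {y}))" .
qed

section \<open>The discretized defect\<close>

lemma quadratic_expansion:
  fixes y :: real
  assumes R: "hermitian n R" and P: "hermitian n P" and X: "X \<in> carrier_mat n n"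
  defines "Y \<equiv> complex_of_real y \<cdot>\<^sub>m 1\<^sub>m n - adj X"
  shows "Re (mtrace (R * (adj Y * P * Y)))
    = y\<^sup>2 * Re (mtrace (R * P)) - 2 * y * Re (mtrace (R * X * P)) + Re (mtrace (adj X * R * X * P))"
proof -
  let ?y = "complex_of_real y"
  have c: "R \<in> carrier_mat n n" "P \<in> carrier_mat n n" and a: "adj R = R" "adj P = P"
    using R P by (auto simp: hermitian_def)
  have aY: "adj Y = ?y \<cdot>\<^sub>m 1\<^sub>m n - X"
    using X by (simp add: Y_def adj_minus[of _ n n])
  have 1: "adj Y * P = ?y \<cdot>\<^sub>m P - X * P"
    unfolding aY using X c by (simp add: minus_mult_distrib_mat[of _ n n _ _ n] mult_smult_assoc_mat[of _ n n _ n] left_mult_one_mat[of _ n n])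
  have Z: "Z * Y = ?y \<cdot>\<^sub>m Z - Z * adj X" if "Z \<in> carrier_mat n n" for Z
    unfolding Y_def using X that by (simp add: mult_minus_distrib_mat[of _ n n _ n] mult_smult_distrib[of _ n n _ n] right_mult_one_mat[of _ n n])
  let ?B = "P * adj X" and ?D = "X * P * adj X"
  have YY: "adj Y * P * Y = ?y \<cdot>\<^sub>m (?y \<cdot>\<^sub>m P - X * P) - (?y \<cdot>\<^sub>m ?B - ?D)"
    unfolding 1 using X c
    by (subst Z) (auto simp: minus_mult_distrib_mat[of _ n n _ _ n] mult_smult_assoc_mat[of _ n n _ n])
  have m: "mtrace (R * (Z - W)) = mtrace (R * Z) - mtrace (R * W)"
    if "Z \<in> carrier_mat n n" "W \<in> carrier_mat n n" for Z W
    using that c by (simp add: mult_minus_distrib_mat[of _ n n _ n] mtrace_minus[of _ n])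
  have s: "mtrace (R * (z \<cdot>\<^sub>m Z)) = z * mtrace (R * Z)" if "Z \<in> carrier_mat n n" for z Z
    using that c by (simp add: mult_smult_distrib[of _ n n _ n] mtrace_smult[of _ n])
  have "mtrace (R * (adj Y * P * Y))
      = ?y * (?y * mtrace (R * P) - mtrace (R * (X * P))) - (?y * mtrace (R * ?B) - mtrace (R * ?D))"
    unfolding YY using X c by (simp add: m s minus_carrier_mat[of _ n n])
  \<comment> \<open>The two cross terms are conjugates of each other, since \<open>R\<close> and
    \<open>P\<close> are Hermitian and the trace is cyclic; this is the origin of the factor
    2.\<close>
  also have "mtrace (R * ?B) = cnj (mtrace (R * (X * P)))"
  proof -
    have "cnj (mtrace (R * (X * P))) = mtrace (adj (R * (X * P)))"
      using X c by (simp add: mtrace_adj[of _ n])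
    also have "adj (R * (X * P)) = ?B * R" using X c a by (simp add: square_adj_mult[of _ n])
    also have "mtrace \<dots> = mtrace (R * ?B)" using X c by (simp add: mtrace_comm[of R n])
    finally show ?thesis ..
  qed
  \<comment> \<open>With \<open>adj X\<close> rotated to the front, the last term is the trace of
    \<open>P\<close> against the psd matrix \<open>adj X * R * X\<close>, which defines an outcome
    measure of its own.\<close>
  also have "mtrace (R * ?D) = mtrace (adj X * R * X * P)"
  proof -
    have "R * ?D = (R * X * P) * adj X" using X c by (simp add: square_assoc[of _ n])
    then have "mtrace (R * ?D) = mtrace (adj X * (R * X * P))"
      using X c by (simp add: mtrace_comm[of _ n "adj X"])
    also have "adj X * (R * X * P) = adj X * R * X * P" using X c by (simp add: square_assoc[of _ n])
    finally show ?thesis .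
  qed
  finally have e: "mtrace (R * (adj Y * P * Y)) = ?y * (?y * mtrace (R * P) - mtrace (R * (X * P)))
      - (?y * cnj (mtrace (R * (X * P))) - mtrace (adj X * R * X * P))" .
  have "R * X * P = R * (X * P)" using X c by (simp add: square_assoc[of _ n])
  then show ?thesis unfolding e by (simp add: power2_eq_square algebra_simps)
qed

text \<open>Discretizing the outcome by a simple function \<open>f\<close> turns the operator-valued integral of
  \<open>(x - X) M(dx) (x - X)\<^sup>\<dagger>\<close> into a finite sum, so no integration against matrix-valued
  measures is needed.\<close>

definition defect :: "nat \<Rightarrow> (real set \<Rightarrow> complex mat) \<Rightarrow> complex mat \<Rightarrow> complex mat \<Rightarrow> (real \<Rightarrow> real) \<Rightarrow> real" where
  "defect n M R X f = (\<Sum>y\<in>range f. Re (mtrace (R *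
     (adj (complex_of_real y \<cdot>\<^sub>m 1\<^sub>m n - adj X) * M (f -` {y}) * (complex_of_real y \<cdot>\<^sub>m 1\<^sub>m n - adj X)))))"

lemma simple_function_vimage: "simple_function borel f \<Longrightarrow> f -` {y :: real} \<in> sets (borel :: real measure)"
  using simple_functionD(2)[of borel f "{y}"] by simp

lemma defect_nonneg:
  assumes M: "is_povm n M" and R: "psd n R" and X: "X \<in> carrier_mat n n" and f: "simple_function borel f"
  shows "0 \<le> defect n M R X f"
  unfolding defect_def
  using povm_psd[OF M simple_function_vimage[OF f]] X
  by (intro sum_nonneg mtrace_psd_mult_nonneg[OF R] psd_congruence) auto

text \<open>The expansion has three terms. The first and the last are already integrals against
  outcome measures; \<open>RX\<close> makes the middle one such by writing the signed measure given
  by \<open>R * X\<close> as a combination of outcome measures.\<close>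

lemma defect_eq:
  assumes M: "is_povm n M" and R: "psd n R" and X: "X \<in> carrier_mat n n"
    and s: "\<And>i. i \<in> I \<Longrightarrow> psd n (\<sigma> i)"
    and RX: "\<And>A. A \<in> sets borel \<Longrightarrow> Re (mtrace (R * X * M A)) = (\<Sum>i\<in>I. d i * Re (mtrace (\<sigma> i * M A)))"
    and f: "simple_function borel f"
  shows "defect n M R X f = (\<integral>x. (f x)\<^sup>2 \<partial>outcome R M)
    - 2 * (\<Sum>i\<in>I. d i * (\<integral>x. f x \<partial>outcome (\<sigma> i) M)) + Re (mtrace (adj X * R * X))"
proof -
  let ?P = "\<lambda>y. M (f -` {y})"
  note meas = simple_function_vimage[OF f]
  have G: "psd n (adj X * R * X)" by (rule psd_congruence[OF R X])
  have hP: "hermitian n (?P y)" for y using povm_psd[OF M meas] by (simp add: psd_def)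
  have hR: "hermitian n R" using R by (simp add: psd_def)
  have "defect n M R X f = (\<Sum>y\<in>range f. y\<^sup>2 * Re (mtrace (R * ?P y)))
      - 2 * (\<Sum>y\<in>range f. y * Re (mtrace (R * X * ?P y))) + (\<Sum>y\<in>range f. Re (mtrace (adj X * R * X * ?P y)))"
    unfolding defect_def quadratic_expansion[OF hR hP X]
    by (simp add: sum.distrib sum_subtractf sum_distrib_left mult.assoc)
  also have "(\<Sum>y\<in>range f. y\<^sup>2 * Re (mtrace (R * ?P y))) = (\<integral>x. (f x)\<^sup>2 \<partial>outcome R M)"
    using integral_simple_function(2)[OF finite_measure_outcome[OF M R] _ f, of "\<lambda>y. y\<^sup>2"]
    by (simp add: measure_outcome[OF M R meas])
  also have "(\<Sum>y\<in>range f. y * Re (mtrace (R * X * ?P y)))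
      = (\<Sum>i\<in>I. d i * (\<Sum>y\<in>range f. y * Re (mtrace (\<sigma> i * ?P y))))"
    unfolding RX[OF meas] sum_distrib_left by (subst sum.swap) (simp add: mult.left_commute)
  also have "\<dots> = (\<Sum>i\<in>I. d i * (\<integral>x. f x \<partial>outcome (\<sigma> i) M))"
    using integral_simple_function(2)[OF finite_measure_outcome[OF M s] _ f, of _ "\<lambda>y. y"]
    by (intro sum.cong) (auto simp: measure_outcome[OF M s meas])
  \<comment> \<open>Integrating the constant 1 adds up the fibres of \<open>f\<close> to the total
    mass of the measure given by \<open>adj X * R * X\<close>.\<close>
  also have "(\<Sum>y\<in>range f. Re (mtrace (adj X * R * X * ?P y))) = Re (mtrace (adj X * R * X))"
    using integral_simple_function(2)[OF finite_measure_outcome[OF M G] _ f, of "\<lambda>y. 1"]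
      measure_outcome_UNIV[OF M G]
    by (simp add: measure_outcome[OF M G meas])
  finally show ?thesis .
qed

text \<open>One sequence has to serve all measures at once: its bound \<open>2 * norm (u x)\<close>
  dominates the first moments under every \<open>\<sigma> i\<close> and, squared, the second moment
  under \<open>R\<close>. The sequence is handed out because the equality case uses it
  again.\<close>

lemma defect_limit:
  fixes u :: "real \<Rightarrow> real"
  assumes M: "is_povm n M" and R: "psd n R" and X: "X \<in> carrier_mat n n"
    and s: "\<And>i. i \<in> I \<Longrightarrow> psd n (\<sigma> i)"
    and RX: "\<And>A. A \<in> sets borel \<Longrightarrow> Re (mtrace (R * X * M A)) = (\<Sum>i\<in>I. d i * Re (mtrace (\<sigma> i * M A)))"
    and u: "u \<in> borel_measurable borel"
    and u2: "integrable (outcome R M) (\<lambda>x. (u x)\<^sup>2)"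
    and u1: "\<And>i. i \<in> I \<Longrightarrow> integrable (outcome (\<sigma> i) M) u"
  obtains F where "\<And>m. simple_function borel (F m)" "\<And>x. (\<lambda>m. F m x) \<longlonglongrightarrow> u x"
    "(\<lambda>m. defect n M R X (F m)) \<longlonglongrightarrow> (\<integral>x. (u x)\<^sup>2 \<partial>outcome R M)
    - 2 * (\<Sum>i\<in>I. d i * (\<integral>x. u x \<partial>outcome (\<sigma> i) M)) + Re (mtrace (adj X * R * X))"
proof -
  obtain F where F: "\<And>m. simple_function borel (F m)" "\<And>x. (\<lambda>m. F m x) \<longlonglongrightarrow> u x"
    "\<And>m x. norm (F m x) \<le> 2 * norm (u x)"
    using borel_measurable_implies_sequence_metric[OF u, of 0] by (auto simp: dist_norm)
  have Fm: "F m \<in> borel_measurable borel" for m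
    by (rule borel_measurable_simple_function[OF F(1)])
  have "(\<lambda>m. \<integral>x. (F m x)\<^sup>2 \<partial>outcome R M) \<longlonglongrightarrow> (\<integral>x. (u x)\<^sup>2 \<partial>outcome R M)"
  proof (rule integral_dominated_convergence[where w = "\<lambda>x. 4 * (u x)\<^sup>2"])
    show "(\<lambda>x. (u x)\<^sup>2) \<in> borel_measurable (outcome R M)" "\<And>m. (\<lambda>x. (F m x)\<^sup>2) \<in> borel_measurable (outcome R M)"
      using u Fm by measurable
    show "integrable (outcome R M) (\<lambda>x. 4 * (u x)\<^sup>2)" using u2 by simp
    show "AE x in outcome R M. (\<lambda>m. (F m x)\<^sup>2) \<longlonglongrightarrow> (u x)\<^sup>2"
      by (intro AE_I2 tendsto_power F(2))
    show "AE x in outcome R M. norm ((F m x)\<^sup>2) \<le> 4 * (u x)\<^sup>2" for m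
      using power_mono[OF F(3), of _ _ 2] by (intro AE_I2) (simp add: power_mult_distrib)
  qed
  moreover have "(\<lambda>m. \<integral>x. F m x \<partial>outcome (\<sigma> i) M) \<longlonglongrightarrow> (\<integral>x. u x \<partial>outcome (\<sigma> i) M)" if i: "i \<in> I" for i
  proof (rule integral_dominated_convergence[where w = "\<lambda>x. 2 * norm (u x)"])
    show "u \<in> borel_measurable (outcome (\<sigma> i) M)" "\<And>m. F m \<in> borel_measurable (outcome (\<sigma> i) M)"
      using u Fm by measurable
    show "integrable (outcome (\<sigma> i) M) (\<lambda>x. 2 * norm (u x))" using u1[OF i] by simp
  qed (use F in auto)
  ultimately have "(\<lambda>m. (\<integral>x. (F m x)\<^sup>2 \<partial>outcome R M)
    - 2 * (\<Sum>i\<in>I. d i * (\<integral>x. F m x \<partial>outcome (\<sigma> i) M)) + Re (mtrace (adj X * R * X))) \<longlonglongrightarrow> (\<integral>x. (u x)\<^sup>2 \<partial>outcome R M)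
    - 2 * (\<Sum>i\<in>I. d i * (\<integral>x. u x \<partial>outcome (\<sigma> i) M)) + Re (mtrace (adj X * R * X))"
    by (auto intro!: tendsto_intros)
  moreover have "defect n M R X (F m) = (\<integral>x. (F m x)\<^sup>2 \<partial>outcome R M)
    - 2 * (\<Sum>i\<in>I. d i * (\<integral>x. F m x \<partial>outcome (\<sigma> i) M)) + Re (mtrace (adj X * R * X))" for m
    by (rule defect_eq[OF M R X _ _ F(1)]) (use s RX in auto)
  ultimately show ?thesis using F(1,2) by (intro that[of F]) simp_all
qed

text \<open>Each summand is at least \<open>c\<close> times \<open>tr (Y P Y)\<close> with
  \<open>Y = y I - X\<close>, and \<open>Y\<close> is diagonal in the eigenbasis of
  \<open>X\<close>, with entries \<open>y - e k\<close>.\<close>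

lemma defect_lower_bound:
  assumes M: "is_povm n M" and U: "unitary_mat n U"
    and X: "X = U * mat_diag n (\<lambda>i. complex_of_real (e i)) * adj U"
    and c: "0 < c" "\<And>P. psd n P \<Longrightarrow> c * Re (mtrace P) \<le> Re (mtrace (R * P))"
    and f: "simple_function borel f"
  shows "(\<Sum>y\<in>range f. c * (\<Sum>k<n. (y - e k)\<^sup>2 * Re ((adj U * M (f -` {y}) * U) $$ (k, k)))) \<le> defect n M R X f"
  unfolding defect_def
proof (rule sum_mono)
  fix y
  let ?y = "complex_of_real y" and ?P = "M (f -` {y})"
  have Uc: "U \<in> carrier_mat n n" "U * adj U = 1\<^sub>m n" using U by (auto simp: unitary_mat_def)
  have P: "psd n ?P" by (rule povm_psd[OF M simple_function_vimage[OF f]])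
  have Pc: "?P \<in> carrier_mat n n" using P by (rule psd_carrier)
  have Xc: "X \<in> carrier_mat n n" using Uc by (simp add: X)
  have aX: "adj X = X" unfolding X using Uc by (simp add: square_adj_mult[of _ n] square_assoc[of _ n])
  let ?D = "mat_diag n (\<lambda>i. complex_of_real (e i))" and ?E = "mat_diag n (\<lambda>i. complex_of_real (y - e i))"
  have E: "?E = ?y \<cdot>\<^sub>m 1\<^sub>m n - ?D" by (rule eq_matI) (auto simp: mat_diag_def)
  have "U * ?E * adj U = U * (?y \<cdot>\<^sub>m 1\<^sub>m n) * adj U - X"
    unfolding X E using Uc(1)
    by (simp add: mult_minus_distrib_mat[of _ n n _ n] minus_mult_distrib_mat[of _ n n _ _ n])
  also have "U * (?y \<cdot>\<^sub>m 1\<^sub>m n) * adj U = ?y \<cdot>\<^sub>m 1\<^sub>m n"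
    using Uc by (simp add: mult_smult_distrib[of _ n n _ n] mult_smult_assoc_mat[of _ n n _ n] right_mult_one_mat[of _ n n])
  finally have Y: "?y \<cdot>\<^sub>m 1\<^sub>m n - adj X = U * ?E * adj U" using aX by simp
  define Y where "Y = ?y \<cdot>\<^sub>m 1\<^sub>m n - adj X"
  have Yc: "Y \<in> carrier_mat n n" using Xc by (simp add: Y_def minus_carrier_mat[of _ n n])
  have aY: "adj Y = Y" unfolding Y_def Y using Uc(1)
    by (simp add: square_adj_mult[of _ n] square_assoc[of _ n] del: of_real_diff)
  have "mtrace (adj Y * ?P * Y) = mtrace (Y * adj Y * ?P)"
    using Yc Pc mtrace_comm[of "adj Y * ?P" n Y] by (simp add: square_assoc[of _ n])
  also have "Y * adj Y = U * mat_diag n (\<lambda>i. complex_of_real (y - e i) * complex_of_real (y - e i)) * adj U"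
    unfolding aY unfolding Y_def Y by (rule unitary_diag_mult[OF U])
  also have "mtrace (\<dots> * ?P) = (\<Sum>k<n. complex_of_real ((y - e k)\<^sup>2) * (adj U * ?P * U) $$ (k, k))"
    unfolding mtrace_unitary_diag_mult[OF U Pc] by (simp add: power2_eq_square)
  finally have t: "Re (mtrace (adj Y * ?P * Y)) = (\<Sum>k<n. (y - e k)\<^sup>2 * Re ((adj U * ?P * U) $$ (k, k)))"
    by (simp del: of_real_power of_real_diff)
  show "c * (\<Sum>k<n. (y - e k)\<^sup>2 * Re ((adj U * ?P * U) $$ (k, k)))
      \<le> Re (mtrace (R * (adj (?y \<cdot>\<^sub>m 1\<^sub>m n - adj X) * ?P * (?y \<cdot>\<^sub>m 1\<^sub>m n - adj X))))"
    unfolding t[symmetric] Y_def[symmetric] by (rule c(2)[OF psd_congruence[OF P Yc]])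
qed

section \<open>Vanishing defect\<close>

lemma unitary_diag_entry:
  assumes "U \<in> carrier_mat n n" "a < n" "b < n"
  shows "(U * mat_diag n f * adj U) $$ (a, b) = (\<Sum>k<n. U $$ (a, k) * f k * cnj (U $$ (b, k)))"
  using assms by (simp add: mat_diag_mult_right[of _ n n] index_mult_sum[of _ n n _ n])

lemma hermitian_diag_real:
  assumes "hermitian n A" "k < n"
  shows "A $$ (k, k) = complex_of_real (Re (A $$ (k, k)))"
proof -
  have "adj A $$ (k, k) = cnj (A $$ (k, k))"
    using hermitian_carrier[OF assms(1)] assms(2) by simp
  then have "cnj (A $$ (k, k)) = A $$ (k, k)" using hermitian_adj[OF assms(1)] by simp
  then show ?thesis by (simp add: complex_eq_iff)
qed

text \<open>The projection onto the \<open>k\<close>-th column of \<open>U\<close> turns a diagonal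
  entry of \<open>adj U * M A * U\<close> into the value of an outcome measure, so that measure
  theory applies to this entry.\<close>

lemma rank_one_projection:
  assumes U: "unitary_mat n U" and k: "k < n"
  obtains \<sigma> where "psd n \<sigma>" "\<And>P. P \<in> carrier_mat n n \<Longrightarrow> mtrace (\<sigma> * P) = (adj U * P * U) $$ (k, k)"
proof
  have Uc: "U \<in> carrier_mat n n" using U by (simp add: unitary_mat_def)
  let ?E = "mat_diag n (\<lambda>l. complex_of_real (if l = k then 1 else 0))"
  have EE: "?E * ?E = ?E"
    unfolding mat_diag_diag by (intro arg_cong[where f = "mat_diag n"] ext) simp
  have "adj (?E * adj U) * (?E * adj U) = U * (?E * ?E) * adj U"
    using Uc by (simp only: square_adj_mult[of _ n] square_assoc[of _ n] adj_mat_diag_real adj_adj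
        adj_carrier mat_diag_dim square_mult_carrier)
  then show "psd n (U * ?E * adj U)" using psd_gram[of "?E * adj U" n] Uc unfolding EE by simp
  show "mtrace (U * ?E * adj U * P) = (adj U * P * U) $$ (k, k)" if "P \<in> carrier_mat n n" for P
    unfolding mtrace_unitary_diag_mult[OF U that] using k
    by (simp add: if_distrib[of complex_of_real] if_distrib[of "\<lambda>x. x * _"] cong: if_cong)
qed

text \<open>The second moment of \<open>F m\<close> about \<open>e k\<close> under the measure of
  the \<open>k\<close>-th diagonal entry is at most the defect divided by \<open>c\<close>, hence
  tends to 0. In the limit \<open>x - a = e k\<close> holds almost everywhere.\<close>

lemma diag_entry_of_vanishing_defect:
  assumes M: "is_povm n M" and U: "unitary_mat n U"
    and X: "X = U * mat_diag n (\<lambda>i. complex_of_real (e i)) * adj U"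
    and c: "0 < c" "\<And>P. psd n P \<Longrightarrow> c * Re (mtrace P) \<le> Re (mtrace (R * P))"
    and F: "\<And>m. simple_function borel (F m)" "\<And>x. (\<lambda>m. F m x) \<longlonglongrightarrow> x - a"
    and lim: "(\<lambda>m. defect n M R X (F m)) \<longlonglongrightarrow> 0"
    and k: "k < n" and A: "A \<in> sets borel"
  shows "(adj U * M A * U) $$ (k, k) = (if a + e k \<in> A then 1 else 0)"
proof -
  have Uc: "U \<in> carrier_mat n n" "adj U * U = 1\<^sub>m n" using U by (auto simp: unitary_mat_def)
  obtain \<sigma> where s: "psd n \<sigma>"
    and st: "\<And>P. P \<in> carrier_mat n n \<Longrightarrow> mtrace (\<sigma> * P) = (adj U * P * U) $$ (k, k)"
    using rank_one_projection[OF U k] by metis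
  let ?N = "outcome \<sigma> M"
  interpret N: finite_measure ?N by (rule finite_measure_outcome[OF M s])
  have mN: "measure ?N B = Re ((adj U * M B * U) $$ (k, k))" if "B \<in> sets borel" for B
    using measure_outcome[OF M s that] st povm_carrier[OF M that] by simp
  have Fm: "F m \<in> borel_measurable borel" for m
    by (rule borel_measurable_simple_function[OF F(1)])
  let ?I = "\<lambda>m. \<integral>x. (F m x - e k)\<^sup>2 \<partial>?N"
  note simple = integral_simple_function[OF N.finite_measure_axioms _ F(1), of "\<lambda>y. (y - e k)\<^sup>2"]
  have I_le: "c * ?I m \<le> defect n M R X (F m)" for m
  proof -
    have "c * ?I m = (\<Sum>y\<in>range (F m). c * ((y - e k)\<^sup>2 * Re ((adj U * M (F m -` {y}) * U) $$ (k, k))))"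
      by (simp add: simple mN[OF simple_function_vimage[OF F(1)]] sum_distrib_left)
    also have "\<dots> \<le> (\<Sum>y\<in>range (F m). c * (\<Sum>k<n. (y - e k)\<^sup>2 * Re ((adj U * M (F m -` {y}) * U) $$ (k, k))))"
    proof (intro sum_mono mult_left_mono)
      fix y
      have "0 \<le> Re ((adj U * M (F m -` {y}) * U) $$ (l, l))" if "l < n" for l
        using povm_psd[OF M simple_function_vimage[OF F(1)]] Uc that unfolding psd_iff by blast
      then show "(y - e k)\<^sup>2 * Re ((adj U * M (F m -` {y}) * U) $$ (k, k))
          \<le> (\<Sum>k<n. (y - e k)\<^sup>2 * Re ((adj U * M (F m -` {y}) * U) $$ (k, k)))"
        using k by (intro member_le_sum) auto
    qed (use c in auto)
    also have "\<dots> \<le> defect n M R X (F m)" by (rule defect_lower_bound[OF M U X c F(1)])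
    finally show ?thesis .
  qed
  have I0: "0 \<le> ?I m" for m by simp
  have "(\<lambda>m. ?I m) \<longlonglongrightarrow> 0"
  proof (rule tendsto_sandwich[OF _ _ tendsto_const])
    show "(\<lambda>m. defect n M R X (F m) / c) \<longlonglongrightarrow> 0" using tendsto_divide[OF lim tendsto_const[of c]] c by simp
    show "\<forall>\<^sub>F m in sequentially. ?I m \<le> defect n M R X (F m) / c"
      using I_le c by (simp add: field_simps)
  qed simp
  then have "(\<lambda>m. ennreal (?I m)) \<longlonglongrightarrow> ennreal 0" by (rule tendsto_ennrealI)
  then have L: "liminf (\<lambda>m. ennreal (?I m)) = 0"
    using lim_imp_Liminf[OF trivial_limit_sequentially] by fastforce
  \<comment> \<open>Fatou's lemma is the right limit theorem here: about \<open>?N\<close> only the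
    pointwise convergence of \<open>F m\<close> and the vanishing of the second moments are known,
    not integrability.\<close>
  have "(\<integral>\<^sup>+x. ennreal ((x - a - e k)\<^sup>2) \<partial>?N) = (\<integral>\<^sup>+x. liminf (\<lambda>m. ennreal ((F m x - e k)\<^sup>2)) \<partial>?N)"
  proof (rule nn_integral_cong)
    fix x
    have "(\<lambda>m. ennreal ((F m x - e k)\<^sup>2)) \<longlonglongrightarrow> ennreal ((x - a - e k)\<^sup>2)"
      by (intro tendsto_ennrealI tendsto_intros F(2))
    then show "ennreal ((x - a - e k)\<^sup>2) = liminf (\<lambda>m. ennreal ((F m x - e k)\<^sup>2))"
      using lim_imp_Liminf[OF trivial_limit_sequentially] by metis
  qed
  also have "\<dots> \<le> liminf (\<lambda>m. \<integral>\<^sup>+x. ennreal ((F m x - e k)\<^sup>2) \<partial>?N)"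
    by (rule nn_integral_liminf) (use Fm in measurable)
  also have "(\<lambda>m. \<integral>\<^sup>+x. ennreal ((F m x - e k)\<^sup>2) \<partial>?N) = (\<lambda>m. ennreal (?I m))"
    using simple(1) by (intro ext nn_integral_eq_integral) auto
  finally have "(\<integral>\<^sup>+x. ennreal ((x - a - e k)\<^sup>2) \<partial>?N) = 0" using L by simp
  then have "AE x in ?N. ennreal ((x - a - e k)\<^sup>2) = 0"
    by (subst (asm) nn_integral_0_iff_AE) measurable
  then have AE: "AE x in ?N. x = a + e k"
    by eventually_elim (simp add: ennreal_eq_0_iff)
  \<comment> \<open>Concentration at a point plus total mass 1 makes \<open>?N\<close> the Dirac
    measure at \<open>a + e k\<close>.\<close>
  have one: "measure ?N UNIV = 1"
    using mN[of UNIV] povm_UNIV[OF M] Uc k by (simp add: right_mult_one_mat[of _ n n])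
  have "measure ?N A = (if a + e k \<in> A then 1 else 0)"
  proof (cases "a + e k \<in> A")
    case True
    have "measure ?N A = measure ?N UNIV"
      by (rule measure_eq_AE) (use AE A True in auto)
    then show ?thesis using one True by simp
  next
    case False
    have "measure ?N A = measure ?N {}"
      by (rule measure_eq_AE) (use AE A False in auto)
    then show ?thesis using False by simp
  qed
  moreover have "hermitian n (adj U * M A * U)"
    using povm_psd[OF M A] Uc by (intro hermitian_congruence) (auto simp: psd_def)
  ultimately show ?thesis
    using mN[OF A] hermitian_diag_real[OF _ k] by (smt (verit) of_real_0 of_real_1)
qed

text \<open>In the eigenbasis every diagonal entry of \<open>N A\<close> is 0 or 1. A zero kills its
  row by positivity. A one is a zero of \<open>N (- A)\<close>, whose off-diagonal entries are the
  negatives of those of \<open>N A\<close>.\<close>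

lemma povm_of_vanishing_defect:
  assumes M: "is_povm n M" and U: "unitary_mat n U"
    and X: "X = U * mat_diag n (\<lambda>i. complex_of_real (e i)) * adj U"
    and c: "0 < c" "\<And>P. psd n P \<Longrightarrow> c * Re (mtrace P) \<le> Re (mtrace (R * P))"
    and F: "\<And>m. simple_function borel (F m)" "\<And>x. (\<lambda>m. F m x) \<longlonglongrightarrow> x - a"
    and lim: "(\<lambda>m. defect n M R X (F m)) \<longlonglongrightarrow> 0"
    and A: "A \<in> sets borel"
  shows "M A = U * mat_diag n (\<lambda>k. if a + e k \<in> A then 1 else 0) * adj U"
proof -
  have Uc: "U \<in> carrier_mat n n" "adj U * U = 1\<^sub>m n" using U by (auto simp: unitary_mat_def)
  have diag: "(adj U * M B * U) $$ (k, k) = (if a + e k \<in> B then 1 else 0)"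
    if "k < n" "B \<in> sets borel" for k B
    by (rule diag_entry_of_vanishing_defect[OF M U X c(1) _ F lim that]) (rule c(2))
  define N where "N B = adj U * M B * U" for B
  have P: "psd n (N B)" if "B \<in> sets borel" for B
    unfolding N_def by (rule psd_congruence[OF povm_psd[OF M that] Uc(1)])
  have Nc: "N B \<in> carrier_mat n n" if "B \<in> sets borel" for B by (rule psd_carrier[OF P[OF that]])
  have A': "- A \<in> sets borel" using A by auto
  have "N A + N (- A) = adj U * (M A + M (- A)) * U"
    unfolding N_def using Uc(1) povm_carrier[OF M A] povm_carrier[OF M A']
    by (simp add: mult_add_distrib_mat[of _ n n _ n] add_mult_distrib_mat[of _ n n _ _ n])
  also have "\<dots> = 1\<^sub>m n"
    unfolding povm_Compl[OF M A] using Uc by (simp add: right_mult_one_mat[of _ n n])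
  finally have sum1: "N A + N (- A) = 1\<^sub>m n" .
  have "N A = mat_diag n (\<lambda>k. if a + e k \<in> A then 1 else 0)"
  proof (rule eq_matI)
    fix k j assume "k < dim_row (mat_diag n (\<lambda>k. if a + e k \<in> A then 1 else 0 :: complex))"
      "j < dim_col (mat_diag n (\<lambda>k. if a + e k \<in> A then 1 else 0 :: complex))"
    then have kj: "k < n" "j < n" by (auto simp: mat_diag_def)
    show "N A $$ (k, j) = mat_diag n (\<lambda>k. if a + e k \<in> A then 1 else 0) $$ (k, j)"
    proof (cases "k = j")
      case True
      then show ?thesis using kj diag[OF kj(1) A] by (simp add: N_def mat_diag_def)
    next
      case False
      have "N A $$ (k, j) = 0"
      proof (cases "a + e k \<in> A")
        case True
        then have "N (- A) $$ (k, k) = 0" using diag[OF kj(1) A'] by (simp add: N_def)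
        then have "N (- A) $$ (k, j) = 0" by (rule psd_zero_diag[OF P[OF A'] kj])
        moreover have "(N A + N (- A)) $$ (k, j) = 0" unfolding sum1 using kj False by simp
        ultimately show ?thesis using kj Nc[OF A'] by simp
      next
        case False
        then have "N A $$ (k, k) = 0" using diag[OF kj(1) A] by (simp add: N_def)
        then show ?thesis by (rule psd_zero_diag[OF P[OF A] kj])
      qed
      then show ?thesis using kj False by (simp add: mat_diag_def)
    qed
  qed (use Nc[OF A] in \<open>auto simp: mat_diag_def\<close>)
  then show ?thesis
    using unitary_congruence_inj[OF U povm_carrier[OF M A] mat_diag_dim] by (simp add: N_def)
qed

section \<open>Spectral measures in diagonal form\<close>

lemma index_msum [simp]: "a < n \<Longrightarrow> b < n \<Longrightarrow> msum n f S $$ (a, b) = (\<Sum>x\<in>S. f x $$ (a, b))"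
  by (simp add: msum_def)

lemma msum_carrier [simp]: "msum n f S \<in> carrier_mat n n"
  by (simp add: msum_def)

lemma msum_dim [simp]: "dim_row (msum n f S) = n" "dim_col (msum n f S) = n"
  by (simp_all add: msum_def)

text \<open>Several \<open>k\<close> may share one value of \<open>e\<close>, so the support is the
  image of \<open>e\<close>, and \<open>M {x}\<close> projects onto the span of all columns of
  \<open>U\<close> with value \<open>x\<close>.\<close>

lemma spectral_measure_of_diag:
  assumes U: "unitary_mat n U"
    and MA: "\<And>A. A \<in> sets borel \<Longrightarrow> M A = U * mat_diag n (\<lambda>k. if e k \<in> A then 1 else 0) * adj U"
  shows "spectral_measure_of n (U * mat_diag n (\<lambda>k. complex_of_real (e k)) * adj U) M"
proof -
  have Uc: "U \<in> carrier_mat n n" "U * adj U = 1\<^sub>m n" using U by (auto simp: unitary_mat_def)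
  let ?S = "e ` {..<n}"
  let ?ind = "\<lambda>A k. if e k \<in> A then 1 else 0 :: complex"
  have MAc: "M A \<in> carrier_mat n n" if "A \<in> sets borel" for A using MA[OF that] Uc by simp
  have ent: "M A $$ (a, b) = (\<Sum>k<n. U $$ (a, k) * ?ind A k * cnj (U $$ (b, k)))"
    if "A \<in> sets borel" "a < n" "b < n" for A a b
    using MA[OF that(1)] unitary_diag_entry[OF Uc(1) that(2,3)] by simp
  have h: "hermitian n (U * mat_diag n (\<lambda>k. complex_of_real (e k)) * adj U)"
    using Uc(1) by (simp add: hermitian_def square_adj_mult[of _ n] square_assoc[of _ n])
  have proj: "is_proj n (M {x})" for x
  proof -
    have r: "(\<lambda>k. ?ind {x} k) = (\<lambda>k. complex_of_real (if e k = x then 1 else 0))" by auto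
    have x: "{x} \<in> sets borel" by simp
    have "M {x} * M {x} = M {x}"
      unfolding MA[OF x] unitary_diag_mult[OF U]
      by (intro arg_cong[where f="\<lambda>f. U * mat_diag n f * adj U"]) auto
    moreover have "adj (M {x}) = M {x}"
      unfolding MA[OF x] r
      using Uc(1) by (simp add: square_adj_mult[of _ n] square_assoc[of _ n])
    ultimately show ?thesis using MAc[of "{x}"] by (simp add: is_proj_def hermitian_def)
  qed
  \<comment> \<open>One identity for three uses: the resolution of the identity, the formula for the
    operator, and the value of \<open>M\<close> on a Borel set.\<close>
  have weighted: "msum n (\<lambda>x. h x \<cdot>\<^sub>m M {x}) (?S \<inter> A) = U * mat_diag n (\<lambda>k. h (e k) * ?ind A k) * adj U" for A h
  proof (rule eq_matI)
    fix a b assume "a < dim_row (U * mat_diag n (\<lambda>k. h (e k) * ?ind A k) * adj U)"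
      "b < dim_col (U * mat_diag n (\<lambda>k. h (e k) * ?ind A k) * adj U)"
    then have ab: "a < n" "b < n" using Uc by auto
    have "msum n (\<lambda>x. h x \<cdot>\<^sub>m M {x}) (?S \<inter> A) $$ (a, b)
        = (\<Sum>x\<in>?S \<inter> A. h x * (\<Sum>k<n. U $$ (a, k) * ?ind {x} k * cnj (U $$ (b, k))))"
      using ab MAc by (simp add: ent carrier_matD[OF MAc])
    also have "\<dots> = (\<Sum>k<n. \<Sum>x\<in>?S \<inter> A. h x * (U $$ (a, k) * ?ind {x} k * cnj (U $$ (b, k))))"
      unfolding sum_distrib_left by (rule sum.swap)
    also have "\<dots> = (\<Sum>k<n. U $$ (a, k) * (h (e k) * ?ind A k) * cnj (U $$ (b, k)))"
    proof (rule sum.cong[OF refl])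
      fix k assume k: "k \<in> {..<n}"
      have "(\<Sum>x\<in>?S \<inter> A. h x * (U $$ (a, k) * ?ind {x} k * cnj (U $$ (b, k))))
          = (\<Sum>x\<in>?S \<inter> A. if x = e k then U $$ (a, k) * h x * cnj (U $$ (b, k)) else 0)"
        by (rule sum.cong) auto
      also have "\<dots> = U $$ (a, k) * (h (e k) * ?ind A k) * cnj (U $$ (b, k))"
        using k by (simp add: sum.delta')
      finally show "(\<Sum>x\<in>?S \<inter> A. h x * (U $$ (a, k) * ?ind {x} k * cnj (U $$ (b, k))))
          = U $$ (a, k) * (h (e k) * ?ind A k) * cnj (U $$ (b, k))" .
    qed
    also have "\<dots> = (U * mat_diag n (\<lambda>k. h (e k) * ?ind A k) * adj U) $$ (a, b)"
      by (rule unitary_diag_entry[OF Uc(1) ab, symmetric])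
    finally show "msum n (\<lambda>x. h x \<cdot>\<^sub>m M {x}) (?S \<inter> A) $$ (a, b)
        = (U * mat_diag n (\<lambda>k. h (e k) * ?ind A k) * adj U) $$ (a, b)" .
  qed (use Uc in auto)
  have one: "msum n (\<lambda>x. (1 :: complex) \<cdot>\<^sub>m M {x}) S = msum n (\<lambda>x. M {x}) S" for S
    by (rule eq_matI) (auto simp: carrier_matD[OF MAc])
  show ?thesis
    unfolding spectral_measure_of_def
  proof (intro conjI h exI[of _ ?S] ballI)
    show "msum n (\<lambda>x. M {x}) ?S = 1\<^sub>m n"
      using weighted[of "\<lambda>_. 1" UNIV] Uc by (simp add: one)
    show "U * mat_diag n (\<lambda>k. complex_of_real (e k)) * adj U = msum n (\<lambda>x. complex_of_real x \<cdot>\<^sub>m M {x}) ?S"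
      using weighted[of complex_of_real UNIV] by simp
    show "M A = msum n (\<lambda>x. M {x}) (?S \<inter> A)" if "A \<in> sets borel" for A
      using weighted[of "\<lambda>_. 1" A] MA[OF that] by (simp add: one)
  qed (use proj in auto)
qed

section \<open>Moments of spectral measures\<close>

lemma mult_msum:
  assumes "A \<in> carrier_mat n n" "\<And>x. x \<in> S \<Longrightarrow> F x \<in> carrier_mat n n"
  shows "A * msum n F S = msum n (\<lambda>x. A * F x) S"
proof (rule eq_matI)
  fix a b assume "a < dim_row (msum n (\<lambda>x. A * F x) S)" "b < dim_col (msum n (\<lambda>x. A * F x) S)"
  then have ab: "a < n" "b < n" by auto
  have "(A * msum n F S) $$ (a, b) = (\<Sum>x\<in>S. \<Sum>l<n. A $$ (a, l) * F x $$ (l, b))"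
    using ab assms by (subst sum.swap) (simp add: index_mult_sum[of _ n n _ n] sum_distrib_left)
  also have "\<dots> = msum n (\<lambda>x. A * F x) S $$ (a, b)"
    using ab assms by (simp add: index_mult_sum[of _ n n _ n])
  finally show "(A * msum n F S) $$ (a, b) = msum n (\<lambda>x. A * F x) S $$ (a, b)" .
qed (use assms in auto)

lemma msum_mult:
  assumes "A \<in> carrier_mat n n" "\<And>x. x \<in> S \<Longrightarrow> F x \<in> carrier_mat n n"
  shows "msum n F S * A = msum n (\<lambda>x. F x * A) S"
proof (rule eq_matI)
  fix a b assume "a < dim_row (msum n (\<lambda>x. F x * A) S)" "b < dim_col (msum n (\<lambda>x. F x * A) S)"
  then have ab: "a < n" "b < n" by auto
  have "(msum n F S * A) $$ (a, b) = (\<Sum>x\<in>S. \<Sum>l<n. F x $$ (a, l) * A $$ (l, b))"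
    using ab assms by (subst sum.swap) (simp add: index_mult_sum[of _ n n _ n] sum_distrib_right)
  also have "\<dots> = msum n (\<lambda>x. F x * A) S $$ (a, b)"
    using ab assms by (simp add: index_mult_sum[of _ n n _ n])
  finally show "(msum n F S * A) $$ (a, b) = msum n (\<lambda>x. F x * A) S $$ (a, b)" .
qed (use assms in auto)

lemma msum_cong: "(\<And>x. x \<in> S \<Longrightarrow> F x = G x) \<Longrightarrow> msum n F S = msum n G S"
  by (simp add: msum_def cong: sum.cong)

lemma mtrace_msum:
  assumes "\<And>x. x \<in> S \<Longrightarrow> F x \<in> carrier_mat n n"
  shows "mtrace (msum n F S) = (\<Sum>x\<in>S. mtrace (F x))"
proof -
  have "mtrace (msum n F S) = (\<Sum>x\<in>S. \<Sum>i<n. F x $$ (i, i))"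
    by (subst sum.swap) (simp add: mtrace_def)
  also have "\<dots> = (\<Sum>x\<in>S. mtrace (F x))"
    using assms by (intro sum.cong) (auto simp: mtrace_def)
  finally show ?thesis .
qed

lemma adj_msum:
  assumes "\<And>x. x \<in> S \<Longrightarrow> F x \<in> carrier_mat n n"
  shows "adj (msum n F S) = msum n (\<lambda>x. adj (F x)) S"
proof (rule eq_matI)
  fix a b assume "a < dim_row (msum n (\<lambda>x. adj (F x)) S)" "b < dim_col (msum n (\<lambda>x. adj (F x)) S)"
  then have ab: "a < n" "b < n" by auto
  then have "adj (F x) $$ (a, b) = cnj (F x $$ (b, a))" if "x \<in> S" for x
    using assms[OF that] by simp
  then show "adj (msum n F S) $$ (a, b) = msum n (\<lambda>x. adj (F x)) S $$ (a, b)"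
    using ab by simp
qed auto

text \<open>The trace is the squared Frobenius norm of \<open>A\<close>.\<close>

lemma mtrace_gram_eq_0:
  assumes A: "A \<in> carrier_mat n n" and z: "Re (mtrace (adj A * A)) = 0"
  shows "A = 0\<^sub>m n n"
proof -
  have "Re (mtrace (adj A * A)) = (\<Sum>j<n. \<Sum>i<n. (cmod (A $$ (i, j)))\<^sup>2)"
  proof -
    have "Re (cnj z * z) = (cmod z)\<^sup>2" for z
      unfolding cmod_power2 by (simp add: power2_eq_square)
    then show ?thesis using A by (simp add: mtrace_def index_mult_sum[of _ n n _ n])
  qed
  then have "\<And>j. j < n \<Longrightarrow> (\<Sum>i<n. (cmod (A $$ (i, j)))\<^sup>2) = 0"
    using z by (simp add: sum_nonneg_eq_0_iff sum_nonneg)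
  then have "\<And>i j. i < n \<Longrightarrow> j < n \<Longrightarrow> A $$ (i, j) = 0"
    by (simp add: sum_nonneg_eq_0_iff)
  then show ?thesis using A by (intro eq_matI) auto
qed

lemma is_proj_psd: "is_proj n P \<Longrightarrow> psd n P"
  using psd_gram[of P n] by (simp add: is_proj_def hermitian_def)

text \<open>Multiplying the resolution of the identity by \<open>P x\<close> and taking traces
  leaves the terms \<open>tr (P z * P x)\<close> with \<open>z\<close> different from
  \<open>x\<close>, which are nonnegative and sum to 0. Each is the squared Frobenius norm of
  \<open>P z * P x\<close>.\<close>

lemma projections_orthogonal:
  assumes S: "finite S" and P: "\<And>x. x \<in> S \<Longrightarrow> is_proj n (P x)" and one: "msum n P S = 1\<^sub>m n"
    and xy: "x \<in> S" "y \<in> S" "x \<noteq> y"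
  shows "P y * P x = 0\<^sub>m n n"
proof (rule mtrace_gram_eq_0)
  have c: "P z \<in> carrier_mat n n" "adj (P z) = P z" "P z * P z = P z" if "z \<in> S" for z
    using P[OF that] by (auto simp: is_proj_def hermitian_def)
  show "P y * P x \<in> carrier_mat n n" using c xy by simp
  have "mtrace (P x) = mtrace (msum n P S * P x)" unfolding one using c[OF xy(1)] by simp
  also have "\<dots> = (\<Sum>z\<in>S. mtrace (P z * P x))"
    using c xy(1) by (subst msum_mult) (auto intro: mtrace_msum)
  also have "\<dots> = mtrace (P x) + (\<Sum>z\<in>S - {x}. mtrace (P z * P x))"
    using S xy(1) c by (subst sum.remove[of S x]) auto
  finally have "(\<Sum>z\<in>S - {x}. Re (mtrace (P z * P x))) = 0" by (simp flip: Re_sum)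
  moreover have "0 \<le> Re (mtrace (P z * P x))" if "z \<in> S - {x}" for z
    using that xy P by (intro mtrace_psd_mult_nonneg[of n] is_proj_psd) auto
  ultimately have z: "Re (mtrace (P y * P x)) = 0"
    using S xy by (subst (asm) sum_nonneg_eq_0_iff) auto
  have "adj (P y * P x) * (P y * P x) = P x * (P y * P y) * P x"
    using c(1,2) xy by (simp add: square_assoc[of _ n] square_adj_mult[of _ n])
  also have "\<dots> = P x * (P y * P x)" unfolding c(3)[OF xy(2)] using c(1) xy by (simp add: square_assoc[of _ n])
  finally have "mtrace (adj (P y * P x) * (P y * P x)) = mtrace ((P y * P x) * P x)"
    using c xy by (simp add: mtrace_comm[of "P x" n])
  also have "P y * P x * P x = P y * P x" using c xy by (simp add: square_assoc[of _ n])
  finally show "Re (mtrace (adj (P y * P x) * (P y * P x))) = 0" using z by simp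
qed

text \<open>The outcome measure sits on the finite set \<open>S\<close>, so moments are finite sums.
  On the operator side, orthogonality gives \<open>X * M {x} = (x - a) M {x}\<close>, which produces
  the same sums for \<open>X\<close> and \<open>X * X\<close>.\<close>

lemma spectral_measure_moments:
  fixes a :: real
  assumes M: "is_povm n M" and T: "spectral_measure_of n T M" and s: "psd n \<sigma>"
  defines "X \<equiv> T - complex_of_real a \<cdot>\<^sub>m 1\<^sub>m n"
  shows "(\<integral>x. (x - a) \<partial>outcome \<sigma> M) = Re (mtrace (\<sigma> * X))"
    and "integrable (outcome \<sigma> M) (\<lambda>x. (x - a)\<^sup>2)"
    and "(\<integral>x. (x - a)\<^sup>2 \<partial>outcome \<sigma> M) = Re (mtrace (\<sigma> * (X * X)))"
proof -
  let ?N = "outcome \<sigma> M"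
  interpret N: finite_measure ?N by (rule finite_measure_outcome[OF M s])
  have sc: "\<sigma> \<in> carrier_mat n n" using s by (rule psd_carrier)
  obtain S where S: "finite S" and P: "\<And>x. x \<in> S \<Longrightarrow> is_proj n (M {x})"
    and one: "msum n (\<lambda>x. M {x}) S = 1\<^sub>m n"
    and TS: "T = msum n (\<lambda>x. complex_of_real x \<cdot>\<^sub>m M {x}) S"
    and MA: "\<And>A. A \<in> sets borel \<Longrightarrow> M A = msum n (\<lambda>x. M {x}) (S \<inter> A)"
    using T unfolding spectral_measure_of_def by blast
  have c: "M {x} \<in> carrier_mat n n" for x by (rule povm_carrier[OF M]) simp
  note cd [simp] = carrier_matD[OF c]
  \<comment> \<open>The identity matrix is expanded as the sum of the \<open>M {x}\<close>, which
    moves the shift by \<open>a\<close> into the coefficients.\<close>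
  have XS: "X = msum n (\<lambda>x. complex_of_real (x - a) \<cdot>\<^sub>m M {x}) S"
    unfolding X_def TS one[symmetric]
    by (rule eq_matI) (auto simp: left_diff_distrib sum_subtractf sum_distrib_left)
  have XM: "X * M {x} = complex_of_real (x - a) \<cdot>\<^sub>m M {x}" if x: "x \<in> S" for x
  proof -
    have PP: "M {y} * M {x} = (if y = x then M {x} else 0\<^sub>m n n)" if y: "y \<in> S" for y
      using projections_orthogonal[OF S P one x y] P[OF x] by (auto simp: is_proj_def)
    have "X * M {x} = msum n (\<lambda>y. complex_of_real (y - a) \<cdot>\<^sub>m M {y} * M {x}) S"
      unfolding XS by (rule msum_mult) (use c in auto)
    also have "\<dots> = msum n (\<lambda>y. if y = x then complex_of_real (x - a) \<cdot>\<^sub>m M {x} else 0\<^sub>m n n) S"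
      by (rule msum_cong) (auto simp: mult_smult_assoc_mat[OF c c] PP)
    also have "\<dots> = complex_of_real (x - a) \<cdot>\<^sub>m M {x}"
    proof (rule eq_matI)
      fix i j assume "i < dim_row (complex_of_real (x - a) \<cdot>\<^sub>m M {x})" "j < dim_col (complex_of_real (x - a) \<cdot>\<^sub>m M {x})"
      then have ij: "i < n" "j < n" by auto
      have "(\<Sum>y\<in>S. (if y = x then complex_of_real (x - a) \<cdot>\<^sub>m M {x} else 0\<^sub>m n n) $$ (i, j))
          = (\<Sum>y\<in>S. if y = x then (complex_of_real (x - a) \<cdot>\<^sub>m M {x}) $$ (i, j) else 0)"
        using ij by (intro sum.cong) auto
      then show "msum n (\<lambda>y. if y = x then complex_of_real (x - a) \<cdot>\<^sub>m M {x} else 0\<^sub>m n n) S $$ (i, j)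
          = (complex_of_real (x - a) \<cdot>\<^sub>m M {x}) $$ (i, j)"
        using ij S x by (simp add: sum.delta)
    qed auto
    finally show ?thesis .
  qed
  have Xc: "X \<in> carrier_mat n n" by (simp add: XS)
  have XX: "X * X = msum n (\<lambda>x. complex_of_real ((x - a)\<^sup>2) \<cdot>\<^sub>m M {x}) S"
  proof -
    have "X * X = msum n (\<lambda>x. X * (complex_of_real (x - a) \<cdot>\<^sub>m M {x})) S"
      by (subst (2) XS, rule mult_msum[OF Xc]) (use c in auto)
    also have "\<dots> = msum n (\<lambda>x. complex_of_real ((x - a)\<^sup>2) \<cdot>\<^sub>m M {x}) S"
      by (rule msum_cong) (auto simp: mult_smult_distrib[OF Xc c] XM power2_eq_square intro!: eq_matI)
    finally show ?thesis .
  qed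
  have tr: "Re (mtrace (\<sigma> * msum n (\<lambda>x. complex_of_real (h x) \<cdot>\<^sub>m M {x}) S))
      = (\<Sum>x\<in>S. h x * Re (mtrace (\<sigma> * M {x})))" for h
    using c sc
    by (subst mult_msum) (auto simp: mtrace_msum mult_smult_distrib[OF sc c] mtrace_smult[of _ n])
  have SB: "S \<in> sets borel" using S by (intro borel_closed finite_imp_closed)
  \<comment> \<open>The complement of the support is a null set, so integrals of Borel functions
    reduce to sums over \<open>S\<close>.\<close>
  have "M (- S) = msum n (\<lambda>x. M {x}) {}" using MA[of "- S"] SB by simp
  also have "\<dots> = 0\<^sub>m n n" by (rule eq_matI) auto
  finally have MS: "M (- S) = 0\<^sub>m n n" .
  have "emeasure ?N (- S) = 0"
    using emeasure_outcome[OF M s, of "- S"] SB sc right_mult_zero_mat[of \<sigma> n n n] MS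
    by (simp add: mtrace_def)
  then have AE: "AE x in ?N. x \<in> S"
    using SB by (intro AE_I[of _ _ "- S"]) auto
  have I: "integrable ?N h \<and> (\<integral>x. h x \<partial>?N) = (\<Sum>x\<in>S. h x * Re (mtrace (\<sigma> * M {x})))"
    if h: "h \<in> borel_measurable borel" for h :: "real \<Rightarrow> real"
  proof -
    let ?h = "\<lambda>z. \<Sum>x\<in>S. h x * indicator {x} z :: real"
    have i: "integrable ?N (\<lambda>z. h x * indicator {x} z :: real)" for x
      by (intro integrable_mult_right integrable_real_indicator) (auto simp: N.emeasure_finite less_top[symmetric])
    have eq: "AE z in ?N. h z = ?h z"
      using AE
    proof eventually_elim
      fix z assume z: "z \<in> S"
      have "?h z = (\<Sum>x\<in>S. if x = z then h z else 0)" by (rule sum.cong) (auto simp: indicator_def)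
      then show "h z = ?h z" using S z by simp
    qed
    have hm: "h \<in> borel_measurable ?N" "?h \<in> borel_measurable ?N" using h by measurable
    have "integrable ?N ?h" by (rule Bochner_Integration.integrable_sum) (rule i)
    then have "integrable ?N h" using integrable_cong_AE[OF hm eq] by simp
    moreover have "(\<integral>x. h x \<partial>?N) = (\<integral>x. ?h x \<partial>?N)" by (rule integral_cong_AE[OF hm eq])
    moreover have "\<dots> = (\<Sum>x\<in>S. \<integral>z. h x * indicator {x} z \<partial>?N)"
      by (rule Bochner_Integration.integral_sum) (rule i)
    moreover have "\<dots> = (\<Sum>x\<in>S. h x * Re (mtrace (\<sigma> * M {x})))"
      by (simp add: measure_outcome[OF M s])
    ultimately show ?thesis by simp
  qed
  show "(\<integral>x. (x - a) \<partial>outcome \<sigma> M) = Re (mtrace (\<sigma> * X))"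
    using I[of "\<lambda>x. x - a"] unfolding XS tr by simp
  show "integrable ?N (\<lambda>x. (x - a)\<^sup>2)" using I[of "\<lambda>x. (x - a)\<^sup>2"] by simp
  show "(\<integral>x. (x - a)\<^sup>2 \<partial>?N) = Re (mtrace (\<sigma> * (X * X)))"
    using I[of "\<lambda>x. (x - a)\<^sup>2"] unfolding XX tr by simp
qed

section \<open>Finite differences and scores\<close>

definition diff_coeff :: "real \<Rightarrow> nat \<Rightarrow> nat \<Rightarrow> real" where
  "diff_coeff \<delta> k i = (-1) ^ k / \<delta> ^ k * ((-1) ^ i * real (k choose i))"

text \<open>Binomial coefficients with \<open>i > k\<close> vanish, so the differences of all orders
  up to \<open>r\<close> share one index set and their sums can be interchanged with sums over
  \<open>k\<close>.\<close>

lemma diff_op_eq_sum: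
  assumes "k \<le> r"
  shows "diff_op \<delta> k f \<theta> = (\<Sum>i\<le>r. diff_coeff \<delta> k i *\<^sub>R f (\<theta> + real i * \<delta>))"
proof -
  have "diff_op \<delta> k f \<theta> = (\<Sum>i\<in>{0..k}. diff_coeff \<delta> k i *\<^sub>R f (\<theta> + real i * \<delta>))"
    by (simp add: diff_op_def diff_coeff_def scaleR_sum_right)
  also have "\<dots> = (\<Sum>i\<le>r. diff_coeff \<delta> k i *\<^sub>R f (\<theta> + real i * \<delta>))"
    using assms by (intro sum.mono_neutral_left) (auto simp: diff_coeff_def)
  finally show ?thesis .
qed

lemma sum_diff_coeff:
  assumes "1 \<le> k" "k \<le> r"
  shows "(\<Sum>i\<le>r. diff_coeff \<delta> k i) = 0"
proof -
  have "(\<Sum>i\<le>r. diff_coeff \<delta> k i) = (\<Sum>i\<le>k. diff_coeff \<delta> k i)"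
    using assms by (intro sum.mono_neutral_right) (auto simp: diff_coeff_def)
  also have "\<dots> = (-1) ^ k / \<delta> ^ k * (\<Sum>i\<le>k. (-1) ^ i * real (k choose i))"
    by (simp add: diff_coeff_def sum_distrib_left)
  also have "\<dots> = 0" using choose_alternating_sum[of k, where 'a = real] assms by simp
  finally show ?thesis .
qed

lemma diff_mat_carrier [simp]: "diff_mat n \<delta> k \<rho> \<theta> \<in> carrier_mat n n"
  by (simp add: diff_mat_def)

lemma mtrace_diff_mat_mult:
  assumes k: "k \<le> r" and \<rho>: "\<And>i. i \<le> r \<Longrightarrow> \<rho> (\<theta> + real i * \<delta>) \<in> carrier_mat n n"
    and P: "P \<in> carrier_mat n n"
  shows "mtrace (diff_mat n \<delta> k \<rho> \<theta> * P)
    = (\<Sum>i\<le>r. complex_of_real (diff_coeff \<delta> k i) * mtrace (\<rho> (\<theta> + real i * \<delta>) * P))"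
proof -
  have "diff_mat n \<delta> k \<rho> \<theta> = msum n (\<lambda>i. complex_of_real (diff_coeff \<delta> k i) \<cdot>\<^sub>m \<rho> (\<theta> + real i * \<delta>)) {..r}"
    using \<rho> by (intro eq_matI) (auto simp: diff_mat_def diff_op_eq_sum[OF k] scaleR_conv_of_real
        carrier_matD[OF \<rho>] intro!: sum.cong)
  then have "mtrace (diff_mat n \<delta> k \<rho> \<theta> * P)
      = (\<Sum>i\<le>r. mtrace (complex_of_real (diff_coeff \<delta> k i) \<cdot>\<^sub>m \<rho> (\<theta> + real i * \<delta>) * P))"
    using \<rho> P by (simp only:) (subst msum_mult[OF P], auto intro!: mtrace_msum)
  also have "\<dots> = (\<Sum>i\<le>r. complex_of_real (diff_coeff \<delta> k i) * mtrace (\<rho> (\<theta> + real i * \<delta>) * P))"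
    using \<rho> P by (intro sum.cong) (auto simp: mult_smult_assoc_mat[of _ n n _ n] mtrace_smult[of _ n])
  finally show ?thesis .
qed

lemma diff_mat_hermitian:
  assumes k: "k \<le> r" and \<rho>: "\<And>i. i \<le> r \<Longrightarrow> hermitian n (\<rho> (\<theta> + real i * \<delta>))"
  shows "hermitian n (diff_mat n \<delta> k \<rho> \<theta>)"
proof -
  have c: "\<rho> (\<theta> + real i * \<delta>) $$ (a, b) = cnj (\<rho> (\<theta> + real i * \<delta>) $$ (b, a))"
    if "i \<le> r" "a < n" "b < n" for i a b
    using hermitian_adj[OF \<rho>[OF that(1)]] hermitian_carrier[OF \<rho>[OF that(1)]] that
    by (metis carrier_matD index_adj)
  have "adj (diff_mat n \<delta> k \<rho> \<theta>) = diff_mat n \<delta> k \<rho> \<theta>"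
    by (rule eq_matI) (auto simp: diff_mat_def diff_op_eq_sum[OF k] scaleR_conv_of_real c[symmetric] intro!: sum.cong)
  then show ?thesis by (simp add: hermitian_def)
qed

lemma LS_props:
  assumes "posdef n (\<rho> \<theta>)" "hermitian n (diff_mat n \<delta> k \<rho> \<theta>)"
  shows "hermitian n (LS n \<rho> \<theta> \<delta> k)"
    "diff_mat n \<delta> k \<rho> \<theta> = (1/2 :: complex) \<cdot>\<^sub>m (\<rho> \<theta> * LS n \<rho> \<theta> \<delta> k + LS n \<rho> \<theta> \<delta> k * \<rho> \<theta>)"
  using theI'[OF sld_ex1[OF assms]] unfolding LS_def by blast+

lemma LR_props:
  assumes "posdef n (\<rho> \<theta>)"
  shows "LR n \<rho> \<theta> \<delta> k \<in> carrier_mat n n" "diff_mat n \<delta> k \<rho> \<theta> = \<rho> \<theta> * LR n \<rho> \<theta> \<delta> k"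
  using theI'[OF rld_ex1[OF assms diff_mat_carrier]] unfolding LR_def by blast+

lemma mtrace_hermitian_mult:
  assumes "hermitian n A" "hermitian n B"
  shows "cnj (mtrace (A * B)) = mtrace (A * B)"
proof -
  have c: "A \<in> carrier_mat n n" "B \<in> carrier_mat n n" "adj A = A" "adj B = B"
    using assms by (auto simp: hermitian_def)
  have "cnj (mtrace (A * B)) = mtrace (adj (A * B))" using c by (simp add: mtrace_adj[of _ n])
  also have "adj (A * B) = B * A" using c by (simp add: square_adj_mult[of _ n])
  also have "mtrace (B * A) = mtrace (A * B)" using c by (simp add: mtrace_comm[of B n])
  finally show ?thesis .
qed

text \<open>The two halves of \<open>D\<close> contribute \<open>tr (R L P)\<close> and
  \<open>tr (L R P)\<close>, which are conjugates of each other for Hermitian factors; their mean is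
  the real part.\<close>

lemma sld_trace:
  assumes R: "hermitian n R" and L: "hermitian n L" and P: "hermitian n P"
    and D: "D = (1/2 :: complex) \<cdot>\<^sub>m (R * L + L * R)"
  shows "Re (mtrace (R * L * P)) = Re (mtrace (D * P))"
proof -
  have c: "R \<in> carrier_mat n n" "L \<in> carrier_mat n n" "P \<in> carrier_mat n n"
    and a: "adj R = R" "adj L = L" "adj P = P"
    using assms by (auto simp: hermitian_def)
  have "mtrace (D * P) = (mtrace (R * L * P) + mtrace (L * R * P)) / 2"
    unfolding D using c
    by (simp add: mult_smult_assoc_mat[of _ n n _ n] add_mult_distrib_mat[of _ n n _ _ n] mtrace_smult[of _ n] mtrace_add[of _ n])
  moreover have "mtrace (L * R * P) = cnj (mtrace (R * L * P))"
  proof -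
    have "cnj (mtrace (R * L * P)) = mtrace (adj (R * L * P))" using c by (simp add: mtrace_adj[of _ n])
    also have "adj (R * L * P) = P * (L * R)" using c a by (simp add: square_adj_mult[of _ n])
    also have "mtrace \<dots> = mtrace (L * R * P)" using c by (simp add: mtrace_comm[of P n])
    finally show ?thesis ..
  qed
  ultimately have "mtrace (D * P) = complex_of_real (Re (mtrace (R * L * P)))"
    by (simp add: complex_add_cnj)
  then show ?thesis by simp
qed

lemma mtrace_score_mult:
  assumes "R \<in> carrier_mat n n" "P \<in> carrier_mat n n" "\<And>k. k \<in> S \<Longrightarrow> L k \<in> carrier_mat n n"
  shows "mtrace (R * msum n (\<lambda>k. a k \<cdot>\<^sub>m L k) S * P) = (\<Sum>k\<in>S. a k * mtrace (R * L k * P))"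
proof -
  have "R * msum n (\<lambda>k. a k \<cdot>\<^sub>m L k) S * P = msum n (\<lambda>k. R * (a k \<cdot>\<^sub>m L k) * P) S"
    using assms by (subst mult_msum) (auto intro!: msum_mult)
  also have "\<dots> = msum n (\<lambda>k. a k \<cdot>\<^sub>m (R * L k * P)) S"
    using assms by (intro msum_cong) (simp add: mult_smult_distrib[of _ n n _ n] mult_smult_assoc_mat[of _ n n _ n])
  finally show ?thesis using assms by (simp add: mtrace_msum mtrace_smult[of _ n])
qed

text \<open>The coefficient of \<open>L i\<close> enters plainly and that of
  \<open>adj (L j)\<close> conjugated, so this is \<open>qform\<close> of the Gram matrix at the
  conjugate of \<open>a\<close>. Later choices of \<open>a\<close> therefore carry a
  \<open>cnj\<close>.\<close>

lemma mtrace_score_gram: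
  fixes a :: "'i \<Rightarrow> complex"
  assumes R: "R \<in> carrier_mat n n" and L: "\<And>k. k \<in> S \<Longrightarrow> L k \<in> carrier_mat n n"
  defines "X \<equiv> msum n (\<lambda>k. a k \<cdot>\<^sub>m L k) S"
  shows "mtrace (adj X * R * X) = (\<Sum>i\<in>S. \<Sum>j\<in>S. a i * cnj (a j) * mtrace (R * L i * adj (L j)))"
proof -
  have X: "X \<in> carrier_mat n n" by (simp add: X_def)
  have aX: "adj X = msum n (\<lambda>k. cnj (a k) \<cdot>\<^sub>m adj (L k)) S"
    unfolding X_def using L by (subst adj_msum) auto
  have "mtrace (adj X * R * X) = mtrace (R * X * adj X)"
    using X R by (simp add: square_assoc[of _ n] mtrace_comm[of "adj X" n])
  also have "\<dots> = (\<Sum>i\<in>S. a i * mtrace (R * L i * adj X))"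
    unfolding X_def using R L X[unfolded X_def] by (intro mtrace_score_mult) auto
  also have "\<dots> = (\<Sum>i\<in>S. a i * (\<Sum>j\<in>S. cnj (a j) * mtrace (R * L i * adj (L j))))"
  proof (rule sum.cong[OF refl])
    fix i assume i: "i \<in> S"
    have c: "R * L i \<in> carrier_mat n n" using R L i by simp
    \<comment> \<open>The trailing identity provides the three-factor shape, with the sum in the
      middle, that \<open>mtrace_score_mult\<close> expects.\<close>
    have "mtrace (R * L i * adj X * 1\<^sub>m n) = (\<Sum>j\<in>S. cnj (a j) * mtrace (R * L i * adj (L j) * 1\<^sub>m n))"
      unfolding aX using c L by (intro mtrace_score_mult) auto
    then show "a i * mtrace (R * L i * adj X) = a i * (\<Sum>j\<in>S. cnj (a j) * mtrace (R * L i * adj (L j)))"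
      using c X L by (simp add: right_mult_one_mat[of _ n n])
  qed
  finally show ?thesis by (simp add: sum_distrib_left mult.assoc)
qed

section \<open>Quadratic forms and matrix-vector products\<close>

lemma qform_eq_scalar_prod:
  "A \<in> carrier_mat n n \<Longrightarrow> w \<in> carrier_vec n \<Longrightarrow>
    qform n A w = (\<Sum>i<n. cnj (vec_index w i) * vec_index (A *\<^sub>v w) i)"
  by (simp add: qform_def scalar_prod_def atLeast0LessThan sum_distrib_left mult.assoc)

lemma sum_cnj_mult_mat_vec:
  assumes A: "A \<in> carrier_mat n n" and "w \<in> carrier_vec n" "z \<in> carrier_vec n"
  shows "(\<Sum>i<n. cnj (vec_index (A *\<^sub>v w) i) * vec_index z i)
    = (\<Sum>i<n. cnj (vec_index w i) * vec_index (adj A *\<^sub>v z) i)"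
proof -
  have "(\<Sum>i<n. cnj (vec_index (A *\<^sub>v w) i) * vec_index z i)
      = (\<Sum>i<n. \<Sum>j<n. cnj (A $$ (i, j)) * cnj (vec_index w j) * vec_index z i)"
    using assms by (simp add: scalar_prod_def atLeast0LessThan sum_distrib_right)
  also have "\<dots> = (\<Sum>j<n. \<Sum>i<n. cnj (A $$ (i, j)) * cnj (vec_index w j) * vec_index z i)"
    by (rule sum.swap)
  also have "\<dots> = (\<Sum>j<n. cnj (vec_index w j) * vec_index (adj A *\<^sub>v z) j)"
    using assms by (simp add: scalar_prod_def atLeast0LessThan sum_distrib_left mult.assoc mult.left_commute)
  finally show ?thesis .
qed

lemma qform_mult_mat_vec:
  assumes A: "hermitian n A" and B: "B \<in> carrier_mat n n" and w: "w \<in> carrier_vec n"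
  shows "qform n B (A *\<^sub>v w) = qform n (A * B * A) w"
proof -
  have c: "A \<in> carrier_mat n n" "adj A = A" using A by (auto simp: hermitian_def)
  have "qform n B (A *\<^sub>v w) = (\<Sum>i<n. cnj (vec_index (A *\<^sub>v w) i) * vec_index (B *\<^sub>v (A *\<^sub>v w)) i)"
    using c B w by (intro qform_eq_scalar_prod) auto
  also have "\<dots> = (\<Sum>i<n. cnj (vec_index w i) * vec_index (adj A *\<^sub>v (B *\<^sub>v (A *\<^sub>v w))) i)"
    using c B w by (intro sum_cnj_mult_mat_vec) auto
  also have "adj A *\<^sub>v (B *\<^sub>v (A *\<^sub>v w)) = (A * B * A) *\<^sub>v w"
    using c B w by (simp add: assoc_mult_mat_vec[of _ n n _ n])
  also have "(\<Sum>i<n. cnj (vec_index w i) * vec_index ((A * B * A) *\<^sub>v w) i) = qform n (A * B * A) w"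
    using c B w by (intro qform_eq_scalar_prod[symmetric]) auto
  finally show ?thesis .
qed

section \<open>The Cramer--Rao bound\<close>

text \<open>The reference value stays \<open>g \<theta>\<close> while the state moves. Unbiasedness
  at the shifted point and total mass 1 account for the difference.\<close>

lemma unbiased_mean:
  fixes \<theta> \<delta> :: real
  assumes model: "\<forall>t\<in>\<Theta>. density_op n (\<rho> t) \<and> posdef n (\<rho> t)"
    and steps: "\<forall>i\<le>r. \<theta> + real i * \<delta> \<in> \<Theta>"
    and M: "is_povm n M" and unb: "unbiased \<Theta> \<rho> M g" and i: "i \<le> r"
  shows "integrable (outcome (\<rho> (\<theta> + real i * \<delta>)) M) (\<lambda>x. x - g \<theta>)"
    "(\<integral>x. (x - g \<theta>) \<partial>outcome (\<rho> (\<theta> + real i * \<delta>)) M) = g (\<theta> + real i * \<delta>) - g \<theta>"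
proof -
  let ?t = "\<theta> + real i * \<delta>"
  have t: "?t \<in> \<Theta>" using steps i by blast
  then have s: "psd n (\<rho> ?t)" "mtrace (\<rho> ?t) = 1" using model by (auto simp: density_op_def)
  interpret finite_measure "outcome (\<rho> ?t) M" by (rule finite_measure_outcome[OF M s(1)])
  have 1: "integrable (outcome (\<rho> ?t) M) (\<lambda>x. x - g ?t)" "(\<integral>x. (x - g ?t) \<partial>outcome (\<rho> ?t) M) = 0"
    using unb t by (auto simp: unbiased_def bias_def)
  have e: "(\<lambda>x. x - g \<theta>) = (\<lambda>x. (x - g ?t) + (g ?t - g \<theta>))" by auto
  show "integrable (outcome (\<rho> ?t) M) (\<lambda>x. x - g \<theta>)"
    unfolding e using 1(1) by (intro Bochner_Integration.integrable_add) auto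
  have "(\<integral>x. (x - g \<theta>) \<partial>outcome (\<rho> ?t) M) = 0 + (\<integral>x. (g ?t - g \<theta>) \<partial>outcome (\<rho> ?t) M)"
    unfolding e using 1 by (subst Bochner_Integration.integral_add) auto
  then show "(\<integral>x. (x - g \<theta>) \<partial>outcome (\<rho> ?t) M) = g ?t - g \<theta>"
    using measure_outcome_UNIV[OF M s(1)] s(2) by simp
qed

text \<open>Differences of order at least 1 annihilate the constant
  \<open>g \<theta>\<close>.\<close>

lemma sum_diff_coeff_increment:
  fixes g :: "real \<Rightarrow> real"
  assumes "1 \<le> k" "k \<le> r"
  shows "(\<Sum>i\<le>r. diff_coeff \<delta> k i * (g (\<theta> + real i * \<delta>) - g \<theta>)) = diff_op \<delta> k g \<theta>"
proof -
  have "(\<Sum>i\<le>r. diff_coeff \<delta> k i * g \<theta>) = 0"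
    using sum_diff_coeff[OF assms, of \<delta>] by (simp flip: sum_distrib_right)
  then show ?thesis
    using diff_op_eq_sum[OF assms(2), of \<delta> g \<theta>] by (simp add: right_diff_distrib sum_subtractf)
qed

text \<open>The family \<open>L\<close> is linked to the model only through \<open>tr\<close>, which
  concerns real parts and Hermitian \<open>P\<close>: the common ground of symmetric derivatives
  with real \<open>a\<close> and right derivatives with complex \<open>a\<close>.\<close>

lemma defect_limit_unbiased:
  fixes \<theta> \<delta> :: real and a :: "nat \<Rightarrow> complex"
  assumes model: "\<forall>t\<in>\<Theta>. density_op n (\<rho> t) \<and> posdef n (\<rho> t)"
    and theta: "\<theta> \<in> \<Theta>" and steps: "\<forall>i\<le>r. \<theta> + real i * \<delta> \<in> \<Theta>"
    and M: "is_povm n M" and unb: "unbiased \<Theta> \<rho> M g"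
    and u2: "integrable (outcome (\<rho> \<theta>) M) (\<lambda>x. (x - g \<theta>)\<^sup>2)"
    and L: "\<And>k. 1 \<le> k \<Longrightarrow> k \<le> r \<Longrightarrow> L k \<in> carrier_mat n n"
    and tr: "\<And>k P. 1 \<le> k \<Longrightarrow> k \<le> r \<Longrightarrow> hermitian n P \<Longrightarrow>
      Re (a k * mtrace (\<rho> \<theta> * L k * P)) = Re (a k) * Re (mtrace (diff_mat n \<delta> k \<rho> \<theta> * P))"
  defines "X \<equiv> msum n (\<lambda>k. a k \<cdot>\<^sub>m L k) {1..r}"
  obtains F where "\<And>m. simple_function borel (F m)" "\<And>x. (\<lambda>m. F m x) \<longlonglongrightarrow> x - g \<theta>"
    "(\<lambda>m. defect n M (\<rho> \<theta>) X (F m)) \<longlonglongrightarrow> (\<integral>x. (x - g \<theta>)\<^sup>2 \<partial>outcome (\<rho> \<theta>) M)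
      - 2 * (\<Sum>k=1..r. Re (a k) * diff_op \<delta> k g \<theta>) + Re (mtrace (adj X * \<rho> \<theta> * X))"
proof -
  let ?\<sigma> = "\<lambda>i. \<rho> (\<theta> + real i * \<delta>)"
  \<comment> \<open>The weight of the \<open>i\<close>-th shifted state in the combination of
    differences with coefficients \<open>Re (a k)\<close>.\<close>
  define d where "d i = (\<Sum>k=1..r. Re (a k) * diff_coeff \<delta> k i)" for i
  have psd: "psd n (\<rho> t)" "mtrace (\<rho> t) = 1" if "t \<in> \<Theta>" for t
    using model that by (auto simp: density_op_def)
  have sp: "psd n (?\<sigma> i)" if "i \<le> r" for i using psd steps that by blast
  note sc = psd_carrier[OF sp]
  have R: "psd n (\<rho> \<theta>)" using psd theta by blast
  have Rc: "\<rho> \<theta> \<in> carrier_mat n n" by (rule psd_carrier[OF R])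
  have RX: "Re (mtrace (\<rho> \<theta> * X * M A)) = (\<Sum>i\<le>r. d i * Re (mtrace (?\<sigma> i * M A)))"
    if A: "A \<in> sets borel" for A
  proof -
    have hM: "hermitian n (M A)" using povm_psd[OF M A] by (simp add: psd_def)
    have Mc: "M A \<in> carrier_mat n n" by (rule povm_carrier[OF M A])
    have "Re (mtrace (\<rho> \<theta> * X * M A)) = (\<Sum>k=1..r. Re (a k * mtrace (\<rho> \<theta> * L k * M A)))"
      unfolding X_def using Rc Mc L by (subst mtrace_score_mult) auto
    also have "\<dots> = (\<Sum>k=1..r. \<Sum>i\<le>r. Re (a k) * diff_coeff \<delta> k i * Re (mtrace (?\<sigma> i * M A)))"
    proof (rule sum.cong[OF refl])
      fix k assume k: "k \<in> {1..r}"
      then have "Re (mtrace (diff_mat n \<delta> k \<rho> \<theta> * M A)) = (\<Sum>i\<le>r. diff_coeff \<delta> k i * Re (mtrace (?\<sigma> i * M A)))"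
        using sc Mc by (subst mtrace_diff_mat_mult[of k r]) auto
      then show "Re (a k * mtrace (\<rho> \<theta> * L k * M A))
          = (\<Sum>i\<le>r. Re (a k) * diff_coeff \<delta> k i * Re (mtrace (?\<sigma> i * M A)))"
        using tr[OF _ _ hM, of k] k by (simp add: sum_distrib_left mult.assoc)
    qed
    also have "\<dots> = (\<Sum>i\<le>r. d i * Re (mtrace (?\<sigma> i * M A)))"
      unfolding d_def sum_distrib_right by (rule sum.swap)
    finally show ?thesis .
  qed
  note mean = unbiased_mean[OF model steps M unb]
  have drift: "(\<Sum>i\<le>r. d i * (\<integral>x. (x - g \<theta>) \<partial>outcome (?\<sigma> i) M))
      = (\<Sum>k=1..r. Re (a k) * diff_op \<delta> k g \<theta>)"
  proof -
    have "(\<Sum>i\<le>r. d i * (\<integral>x. (x - g \<theta>) \<partial>outcome (?\<sigma> i) M))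
        = (\<Sum>i\<le>r. \<Sum>k=1..r. Re (a k) * (diff_coeff \<delta> k i * (g (\<theta> + real i * \<delta>) - g \<theta>)))"
      by (simp add: mean d_def sum_distrib_right mult.assoc)
    also have "\<dots> = (\<Sum>k=1..r. Re (a k) * (\<Sum>i\<le>r. diff_coeff \<delta> k i * (g (\<theta> + real i * \<delta>) - g \<theta>)))"
      unfolding sum_distrib_left by (rule sum.swap)
    also have "\<dots> = (\<Sum>k=1..r. Re (a k) * diff_op \<delta> k g \<theta>)"
      by (rule sum.cong) (auto simp: sum_diff_coeff_increment)
    finally show ?thesis .
  qed
  have Xc: "X \<in> carrier_mat n n" by (simp add: X_def)
  obtain F where "\<And>m. simple_function borel (F m)" "\<And>x. (\<lambda>m. F m x) \<longlonglongrightarrow> x - g \<theta>"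
    "(\<lambda>m. defect n M (\<rho> \<theta>) X (F m)) \<longlonglongrightarrow> (\<integral>x. (x - g \<theta>)\<^sup>2 \<partial>outcome (\<rho> \<theta>) M)
      - 2 * (\<Sum>i\<le>r. d i * (\<integral>x. (x - g \<theta>) \<partial>outcome (?\<sigma> i) M)) + Re (mtrace (adj X * \<rho> \<theta> * X))"
    by (rule defect_limit[OF M R Xc, of "{..r}" ?\<sigma> d "\<lambda>x. x - g \<theta>"]) (use sp RX u2 mean in auto)
  then show ?thesis unfolding drift by (rule that)
qed

text \<open>This is \<open>K^- K K^- = K^-\<close>, read at the optimal coefficients; it identifies
  the quadratic term of the defect with the bound.\<close>

lemma crbound_eq_qform:
  assumes K: "hermitian r K" and v: "v \<in> carrier_vec r"
  shows "crbound K v r = Re (qform r K (mp_inverse K *\<^sub>v v))"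
proof -
  note mp = mp_inverse_hermitian[OF K]
  have "qform r K (mp_inverse K *\<^sub>v v) = qform r (mp_inverse K) v"
    using qform_mult_mat_vec[OF mp(2) hermitian_carrier[OF K] v] mp(1) by (simp add: is_mp_inverse_def)
  then show ?thesis by (simp add: crbound_def)
qed

text \<open>This is \<open>K K^- K = K\<close>; it evaluates the bound when the differences of
  \<open>g\<close> have the form \<open>K c\<close>, as in the converse of the equality
  claim.\<close>

lemma crbound_range:
  assumes K: "hermitian r K" and c: "c \<in> carrier_vec r"
  shows "crbound K (K *\<^sub>v c) r = Re (qform r K c)"
  using qform_mult_mat_vec[OF K hermitian_carrier[OF mp_inverse_hermitian(2)[OF K]] c]
    mp_inverse_hermitian(1)[OF K] by (simp add: crbound_def is_mp_inverse_def)

text \<open>The coefficients \<open>w = K\<^sup>- v\<close> minimize the quadratic form of \<open>defect_limit_unbiased\<close>.\<close>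

lemma defect_limit_optimal:
  fixes \<theta> \<delta> :: real
  assumes model: "\<forall>t\<in>\<Theta>. density_op n (\<rho> t) \<and> posdef n (\<rho> t)"
    and theta: "\<theta> \<in> \<Theta>" and steps: "\<forall>i\<le>r. \<theta> + real i * \<delta> \<in> \<Theta>"
    and M: "is_povm n M" and unb: "unbiased \<Theta> \<rho> M g"
    and u2: "integrable (outcome (\<rho> \<theta>) M) (\<lambda>x. (x - g \<theta>)\<^sup>2)"
    and L: "\<And>k. 1 \<le> k \<Longrightarrow> k \<le> r \<Longrightarrow> L k \<in> carrier_mat n n"
    and K: "hermitian r K"
  defines "w \<equiv> mp_inverse K *\<^sub>v vdiff g \<theta> \<delta> r"
  defines "a \<equiv> (\<lambda>k. cnj (vec_index w (k - 1)))"
  defines "X \<equiv> msum n (\<lambda>k. a k \<cdot>\<^sub>m L k) {1..r}"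
  assumes tr: "\<And>k P. 1 \<le> k \<Longrightarrow> k \<le> r \<Longrightarrow> hermitian n P \<Longrightarrow>
      Re (a k * mtrace (\<rho> \<theta> * L k * P)) = Re (a k) * Re (mtrace (diff_mat n \<delta> k \<rho> \<theta> * P))"
    and gram: "Re (mtrace (adj X * \<rho> \<theta> * X)) = Re (qform r K w)"
  obtains F where "\<And>m. simple_function borel (F m)" "\<And>x. (\<lambda>m. F m x) \<longlonglongrightarrow> x - g \<theta>"
    "(\<lambda>m. defect n M (\<rho> \<theta>) X (F m)) \<longlonglongrightarrow> (\<integral>x. (x - g \<theta>)\<^sup>2 \<partial>outcome (\<rho> \<theta>) M)
      - crbound K (vdiff g \<theta> \<delta> r) r"
proof -
  let ?v = "vdiff g \<theta> \<delta> r"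
  have v: "?v \<in> carrier_vec r" by (simp add: vdiff_def)
  note mp = mp_inverse_hermitian[OF K]
  have mc: "mp_inverse K \<in> carrier_mat r r" using mp(2) by (rule hermitian_carrier)
  have q: "Re (mtrace (adj X * \<rho> \<theta> * X)) = crbound K ?v r"
    using gram crbound_eq_qform[OF K v] by (simp add: w_def)
  \<comment> \<open>The linear term. The index is shifted because entry \<open>i\<close> of
    \<open>vdiff\<close> holds the difference of order \<open>i + 1\<close>; the conjugate in
    \<open>a\<close> disappears under \<open>Re\<close>.\<close>
  have "(\<Sum>k=1..r. Re (a k) * diff_op \<delta> k g \<theta>) = (\<Sum>i<r. Re (vec_index w i) * diff_op \<delta> (Suc i) g \<theta>)"
    unfolding One_nat_def sum.atLeast1_atMost_eq by (simp add: a_def)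
  also have "\<dots> = Re (\<Sum>i<r. cnj (vec_index ?v i) * vec_index w i)"
    by (simp add: vdiff_def mult.commute)
  also have "\<dots> = crbound K ?v r"
    using qform_eq_scalar_prod[OF mc v] by (simp add: crbound_def w_def)
  finally have s: "(\<Sum>k=1..r. Re (a k) * diff_op \<delta> k g \<theta>) = crbound K ?v r" .
  obtain F where "\<And>m. simple_function borel (F m)" "\<And>x. (\<lambda>m. F m x) \<longlonglongrightarrow> x - g \<theta>"
    "(\<lambda>m. defect n M (\<rho> \<theta>) X (F m)) \<longlonglongrightarrow> (\<integral>x. (x - g \<theta>)\<^sup>2 \<partial>outcome (\<rho> \<theta>) M)
      - 2 * (\<Sum>k=1..r. Re (a k) * diff_op \<delta> k g \<theta>) + Re (mtrace (adj X * \<rho> \<theta> * X))"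
    unfolding X_def
    by (rule defect_limit_unbiased[OF model theta steps M unb u2, of L a]) (use L tr in auto)
  \<comment> \<open>Linear and quadratic term are the same number \<open>b\<close>, so
    \<open>- 2 b + b = - b\<close>.\<close>
  then show ?thesis unfolding s q by (intro that[of F]) simp_all
qed

lemma mse_eq_integral:
  "integrable (outcome (\<rho> \<theta>) M) (\<lambda>x. (x - g \<theta>)\<^sup>2) \<Longrightarrow>
    mse \<rho> M g \<theta> = ennreal (\<integral>x. (x - g \<theta>)\<^sup>2 \<partial>outcome (\<rho> \<theta>) M)"
  unfolding mse_def by (rule nn_integral_eq_integral) auto

lemma mse_finite_imp_integrable:
  assumes "mse \<rho> M g \<theta> < \<infinity>"
  shows "integrable (outcome (\<rho> \<theta>) M) (\<lambda>x. (x - g \<theta>)\<^sup>2)"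
proof (rule integrableI_bounded)
  show "(\<lambda>x. (x - g \<theta>)\<^sup>2) \<in> borel_measurable (outcome (\<rho> \<theta>) M)" by measurable
  show "(\<integral>\<^sup>+x. ennreal (norm ((x - g \<theta>)\<^sup>2)) \<partial>outcome (\<rho> \<theta>) M) < \<infinity>"
    using assms by (simp add: mse_def)
qed

text \<open>Conjugate symmetry of the Gram entries: it makes \<open>KR\<close> Hermitian and, after
  taking real parts, \<open>KS\<close> symmetric.\<close>

lemma mtrace_gram_cnj:
  assumes R: "hermitian n R" and A: "A \<in> carrier_mat n n" and B: "B \<in> carrier_mat n n"
  shows "cnj (mtrace (R * A * adj B)) = mtrace (R * B * adj A)"
proof -
  have c: "R \<in> carrier_mat n n" "adj R = R" using R by (auto simp: hermitian_def)
  have "cnj (mtrace (R * A * adj B)) = mtrace (adj (R * A * adj B))"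
    using c A B by (simp add: mtrace_adj[of _ n])
  also have "adj (R * A * adj B) = (B * adj A) * R"
    using c A B by (simp add: square_adj_mult[of _ n] square_assoc[of _ n])
  also have "mtrace \<dots> = mtrace (R * (B * adj A))" using c A B by (simp add: mtrace_comm[of R n])
  also have "R * (B * adj A) = R * B * adj A" using c A B by (simp add: square_assoc[of _ n])
  finally show ?thesis .
qed

text \<open>The defects are nonnegative, hence so is their limit \<open>V - b\<close>. Only a finite
  mean square error supplies the square integrability behind that limit; for an infinite one the
  bound is trivial.\<close>

lemma crbound_le_mse:
  fixes \<theta> \<delta> :: real
  assumes model: "\<forall>t\<in>\<Theta>. density_op n (\<rho> t) \<and> posdef n (\<rho> t)"
    and theta: "\<theta> \<in> \<Theta>" and steps: "\<forall>i\<le>r. \<theta> + real i * \<delta> \<in> \<Theta>"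
    and M: "is_povm n M" and unb: "unbiased \<Theta> \<rho> M g"
    and L: "\<And>k. 1 \<le> k \<Longrightarrow> k \<le> r \<Longrightarrow> L k \<in> carrier_mat n n"
    and K: "hermitian r K"
  defines "w \<equiv> mp_inverse K *\<^sub>v vdiff g \<theta> \<delta> r"
  defines "a \<equiv> (\<lambda>k. cnj (vec_index w (k - 1)))"
  defines "X \<equiv> msum n (\<lambda>k. a k \<cdot>\<^sub>m L k) {1..r}"
  assumes tr: "\<And>k P. 1 \<le> k \<Longrightarrow> k \<le> r \<Longrightarrow> hermitian n P \<Longrightarrow>
      Re (a k * mtrace (\<rho> \<theta> * L k * P)) = Re (a k) * Re (mtrace (diff_mat n \<delta> k \<rho> \<theta> * P))"
    and gram: "Re (mtrace (adj X * \<rho> \<theta> * X)) = Re (qform r K w)"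
  shows "ennreal (crbound K (vdiff g \<theta> \<delta> r) r) \<le> mse \<rho> M g \<theta>"
proof (cases "mse \<rho> M g \<theta> < \<infinity>")
  case True
  then have u2: "integrable (outcome (\<rho> \<theta>) M) (\<lambda>x. (x - g \<theta>)\<^sup>2)"
    by (rule mse_finite_imp_integrable)
  obtain F where F: "\<And>m. simple_function borel (F m)"
    "(\<lambda>m. defect n M (\<rho> \<theta>) X (F m)) \<longlonglongrightarrow> (\<integral>x. (x - g \<theta>)\<^sup>2 \<partial>outcome (\<rho> \<theta>) M)
      - crbound K (vdiff g \<theta> \<delta> r) r"
    unfolding X_def a_def w_def
    by (rule defect_limit_optimal[OF model theta steps M unb u2 L K])
      (use tr gram in \<open>auto simp: X_def a_def w_def\<close>)
  have R: "psd n (\<rho> \<theta>)" using model theta by (auto simp: density_op_def)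
  have "0 \<le> defect n M (\<rho> \<theta>) X (F m)" for m
    by (rule defect_nonneg[OF M R _ F(1)]) (simp add: X_def)
  then have "0 \<le> (\<integral>x. (x - g \<theta>)\<^sup>2 \<partial>outcome (\<rho> \<theta>) M) - crbound K (vdiff g \<theta> \<delta> r) r"
    by (intro LIMSEQ_le_const[OF F(2)]) auto
  then show ?thesis unfolding mse_eq_integral[of \<rho> \<theta> M g, OF u2] by (intro ennreal_leI) simp
next
  case False
  then show ?thesis by (simp add: not_less top_unique)
qed

theorem theorem2:
  fixes n r :: nat and \<Theta> :: "real set" and \<rho> :: "real \<Rightarrow> complex mat"
    and g :: "real \<Rightarrow> real" and \<theta> \<delta> :: real and M :: "real set \<Rightarrow> complex mat"
  assumes model: "\<forall>t\<in>\<Theta>. density_op n (\<rho> t) \<and> posdef n (\<rho> t)"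
    and theta: "\<theta> \<in> \<Theta>" and delta: "\<delta> \<noteq> 0" and r: "r \<ge> 1"
    and steps: "\<forall>i\<le>r. \<theta> + real i * \<delta> \<in> \<Theta>"
    and povm: "is_povm n M"
    and unb: "unbiased \<Theta> \<rho> M g"
  shows "ennreal (crbound (KS n \<rho> \<theta> \<delta> r) (vdiff g \<theta> \<delta> r) r) \<le> mse \<rho> M g \<theta>
     \<and> ennreal (crbound (KR n \<rho> \<theta> \<delta> r) (vdiff g \<theta> \<delta> r) r) \<le> mse \<rho> M g \<theta>
     \<and> (mse \<rho> M g \<theta> = ennreal (crbound (KS n \<rho> \<theta> \<delta> r) (vdiff g \<theta> \<delta> r) r) \<longleftrightarrow>
          (\<exists>T. spectral_measure_of n T M \<and>
             (\<exists>c :: nat \<Rightarrow> real. T - g \<theta> \<cdot>\<^sub>m 1\<^sub>m n =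
                 msum n (\<lambda>i. complex_of_real (c i) \<cdot>\<^sub>m LS n \<rho> \<theta> \<delta> i) {1..r})))"
proof -
  let ?R = "\<rho> \<theta>" and ?v = "vdiff g \<theta> \<delta> r" and ?D = "\<lambda>k. diff_mat n \<delta> k \<rho> \<theta>"
  let ?LS = "LS n \<rho> \<theta> \<delta>" and ?LR = "LR n \<rho> \<theta> \<delta>" and ?\<sigma> = "\<lambda>i. \<rho> (\<theta> + real i * \<delta>)"
  let ?KS = "KS n \<rho> \<theta> \<delta> r" and ?KR = "KR n \<rho> \<theta> \<delta> r"
  have pd: "posdef n ?R" and R: "psd n ?R" using model theta by (auto simp: density_op_def)
  have hR: "hermitian n ?R" using R by (simp add: psd_def)
  have Rc: "?R \<in> carrier_mat n n" using R by (rule psd_carrier)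
  have sp: "psd n (?\<sigma> i)" if "i \<le> r" for i
    using model steps that by (auto simp: density_op_def)
  note sc = psd_carrier[OF sp]
  have hD: "hermitian n (?D k)" if "k \<le> r" for k
    using that sp by (intro diff_mat_hermitian[of k r]) (auto simp: psd_def)
  have hLS: "hermitian n (?LS k)" if "k \<le> r" for k by (rule LS_props(1)[of n \<rho> \<theta>, OF pd hD[OF that]])
  note LSc = hermitian_carrier[OF hLS] and LSa = hermitian_adj[OF hLS]
  note LRc = LR_props(1)[of n \<rho> \<theta>, OF pd]
  have v: "?v \<in> carrier_vec r" by (simp add: vdiff_def)
  have trS: "Re (mtrace (?R * ?LS k * P)) = Re (mtrace (?D k * P))"
    if "k \<le> r" "hermitian n P" for k P
    by (rule sld_trace[OF hR hLS[OF that(1)] that(2) LS_props(2)[of n \<rho> \<theta>, OF pd hD[OF that(1)]]])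
  have KSc: "?KS \<in> carrier_mat r r" by (simp add: KS_def)
  \<comment> \<open>The Hermitian second factor is written as an adjoint to fit
    \<open>mtrace_score_gram\<close>; matrix indices start at 0, orders of differences at 1.\<close>
  have KS_index: "?KS $$ (i, j) = complex_of_real (Re (mtrace (?R * ?LS (Suc i) * adj (?LS (Suc j)))))"
    if "i < r" "j < r" for i j
    using that LSa[of "Suc j"] by (simp add: KS_def)
  have hKS: "hermitian r ?KS"
    unfolding hermitian_def
  proof (intro conjI KSc eq_matI)
    fix i j assume "i < dim_row ?KS" "j < dim_col ?KS"
    then have ij: "i < r" "j < r" using KSc by auto
    have "Re (mtrace (?R * ?LS (Suc j) * adj (?LS (Suc i)))) = Re (mtrace (?R * ?LS (Suc i) * adj (?LS (Suc j))))"
      using mtrace_gram_cnj[OF hR LSc LSc, of "Suc j" "Suc i"] ij by (metis Suc_leI cnj.simps(1))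
    then show "adj ?KS $$ (i, j) = ?KS $$ (i, j)" using ij KSc by (simp add: KS_index)
  qed (use KSc in auto)
  have hKR: "hermitian r ?KR"
    unfolding hermitian_def
  proof (intro conjI eq_matI)
    fix i j assume "i < dim_row ?KR" "j < dim_col ?KR"
    then have ij: "i < r" "j < r" by (auto simp: KR_def)
    then show "adj ?KR $$ (i, j) = ?KR $$ (i, j)"
      using mtrace_gram_cnj[OF hR LRc LRc] by (simp add: KR_def)
  qed (auto simp: KR_def)
  \<comment> \<open>With real coefficients only the real parts of the traces enter, and these are
    what \<open>KS\<close> records.\<close>
  have gramS: "Re (mtrace (adj X * ?R * X)) = Re (qform r ?KS w)"
    if X: "X = msum n (\<lambda>k. complex_of_real (c k) \<cdot>\<^sub>m ?LS k) {1..r}"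
      and w: "\<And>i. i < r \<Longrightarrow> vec_index w i = complex_of_real (c (Suc i))" for X w c
  proof -
    have "mtrace (adj X * ?R * X)
        = (\<Sum>i<r. \<Sum>j<r. complex_of_real (c (Suc i)) * cnj (complex_of_real (c (Suc j))) * mtrace (?R * ?LS (Suc i) * adj (?LS (Suc j))))"
      unfolding X using LSc Rc by (subst mtrace_score_gram) (auto simp: sum.atLeast1_atMost_eq)
    then have "Re (mtrace (adj X * ?R * X))
        = (\<Sum>i<r. \<Sum>j<r. c (Suc i) * c (Suc j) * Re (mtrace (?R * ?LS (Suc i) * adj (?LS (Suc j)))))"
      by (simp flip: of_real_mult)
    also have "\<dots> = Re (qform r ?KS w)"
      by (simp add: qform_def w KS_index mult_ac flip: of_real_mult)
    finally show ?thesis .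
  qed
  \<comment> \<open>The optimal coefficients. They are real because \<open>KS\<close> and
    \<open>vdiff\<close> are, and this makes the operator \<open>?X\<close> below Hermitian.\<close>
  define w where "w = mp_inverse ?KS *\<^sub>v ?v"
  define c where "c k = Re (vec_index w (k - 1))" for k
  have wc: "vec_index w i = complex_of_real (c (Suc i))" if "i < r" for i
  proof -
    have "vec_index w i = (\<Sum>j<r. mp_inverse ?KS $$ (i, j) * vec_index ?v j)"
      using hermitian_carrier[OF mp_inverse_hermitian(2)[OF hKS]] v that
      by (simp add: w_def scalar_prod_def atLeast0LessThan)
    moreover have "mp_inverse ?KS $$ (i, j) \<in> \<real>" if "j < r" for j
      using mp_inverse_real[OF hKS _ \<open>i < r\<close> that] by (simp add: KS_index)
    ultimately have "vec_index w i \<in> \<real>"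
      by (auto intro!: sum_in_Reals Reals_mult simp: vdiff_def)
    then show ?thesis by (simp add: c_def)
  qed
  have wcnj: "cnj (vec_index w (k - 1)) = complex_of_real (c k)" if "1 \<le> k" "k \<le> r" for k
  proof -
    have "vec_index w (k - 1) = complex_of_real (c k)" using wc[of "k - 1"] that by simp
    then show ?thesis by simp
  qed
  let ?X = "msum n (\<lambda>k. complex_of_real (c k) \<cdot>\<^sub>m ?LS k) {1..r}"
  have X_eq: "msum n (\<lambda>k. cnj (vec_index w (k - 1)) \<cdot>\<^sub>m ?LS k) {1..r} = ?X"
    by (rule msum_cong) (simp only: wcnj atLeastAtMost_iff)
  have trw: "Re (cnj (vec_index w (k - 1)) * mtrace (?R * ?LS k * P))
      = Re (cnj (vec_index w (k - 1))) * Re (mtrace (?D k * P))"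
    if "1 \<le> k" "k \<le> r" "hermitian n P" for k P
    unfolding wcnj[OF that(1,2)] using that trS[of k P] by simp
  have gramw: "Re (mtrace (adj ?X * ?R * ?X)) = Re (qform r ?KS w)"
    by (rule gramS[OF refl wc])
  have bound_S: "ennreal (crbound ?KS ?v r) \<le> mse \<rho> M g \<theta>"
    by (rule crbound_le_mse[OF model theta steps povm unb, of ?LS])
      (use LSc hKS trw gramw X_eq in \<open>auto simp flip: w_def\<close>)
  have bound_R: "ennreal (crbound ?KR ?v r) \<le> mse \<rho> M g \<theta>"
  proof (rule crbound_le_mse[OF model theta steps povm unb, of ?LR])
    define z where "z = mp_inverse ?KR *\<^sub>v ?v"
    \<comment> \<open>A trace of a product of two Hermitian matrices is real, so a complex
      coefficient factors out under \<open>Re\<close>.\<close>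
    have real: "Im (mtrace (?D k * P)) = 0" if "k \<le> r" "hermitian n P" for k P
      using mtrace_hermitian_mult[OF hD[OF that(1)] that(2)] by (simp add: complex_eq_iff)
    show "Re (cnj (vec_index (mp_inverse ?KR *\<^sub>v ?v) (k - 1)) * mtrace (?R * ?LR k * P))
        = Re (cnj (vec_index (mp_inverse ?KR *\<^sub>v ?v) (k - 1))) * Re (mtrace (?D k * P))"
      if "1 \<le> k" "k \<le> r" "hermitian n P" for k P
      using real[OF that(2,3)] by (simp flip: LR_props(2)[of n \<rho> \<theta>, OF pd])
    let ?Y = "msum n (\<lambda>k. cnj (vec_index z (k - 1)) \<cdot>\<^sub>m ?LR k) {1..r}"
    have "mtrace (adj ?Y * ?R * ?Y)
        = (\<Sum>i<r. \<Sum>j<r. cnj (vec_index z i) * vec_index z j * mtrace (?R * ?LR (Suc i) * adj (?LR (Suc j))))"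
      using LRc Rc by (subst mtrace_score_gram) (auto simp: sum.atLeast1_atMost_eq)
    also have "\<dots> = qform r ?KR z"
      by (simp add: qform_def KR_def mult_ac)
    finally show "Re (mtrace (adj (msum n (\<lambda>k. cnj (vec_index (mp_inverse ?KR *\<^sub>v ?v) (k - 1)) \<cdot>\<^sub>m ?LR k) {1..r}) * ?R
          * msum n (\<lambda>k. cnj (vec_index (mp_inverse ?KR *\<^sub>v ?v) (k - 1)) \<cdot>\<^sub>m ?LR k) {1..r}))
        = Re (qform r ?KR (mp_inverse ?KR *\<^sub>v ?v))"
      by (simp add: z_def)
  qed (use LRc hKR in auto)
  have hermX: "hermitian n (msum n (\<lambda>k. complex_of_real (f k) \<cdot>\<^sub>m ?LS k) {1..r})" for f
    using LSc LSa unfolding hermitian_def by (subst adj_msum) (auto intro!: msum_cong)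

  \<comment> \<open>Equality forces a spectral measure\<close>
  have "\<exists>T. spectral_measure_of n T M \<and> (\<exists>c :: nat \<Rightarrow> real. T - g \<theta> \<cdot>\<^sub>m 1\<^sub>m n =
      msum n (\<lambda>i. complex_of_real (c i) \<cdot>\<^sub>m ?LS i) {1..r})"
    if eq: "mse \<rho> M g \<theta> = ennreal (crbound ?KS ?v r)"
  proof -
    have u2: "integrable (outcome ?R M) (\<lambda>x. (x - g \<theta>)\<^sup>2)"
      using eq by (intro mse_finite_imp_integrable) simp
    \<comment> \<open>\<open>ennreal\<close> sends negative reals to 0, so equality there gives
      equality of the real numbers only once the bound is known to be nonnegative.\<close>
    have "0 \<le> Re (mtrace (adj ?X * ?R * ?X))"
      using mtrace_psd_mult_nonneg[OF psd_congruence[OF R] psd_one, of ?X]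
      by (simp add: right_mult_one_mat[of _ n n] Rc)
    then have "0 \<le> crbound ?KS ?v r"
      unfolding gramw crbound_eq_qform[OF hKS v] w_def .
    then have V: "(\<integral>x. (x - g \<theta>)\<^sup>2 \<partial>outcome ?R M) = crbound ?KS ?v r"
      using eq unfolding mse_eq_integral[of \<rho> \<theta> M g, OF u2] by simp
    obtain F where F: "\<And>m. simple_function borel (F m)" "\<And>x. (\<lambda>m. F m x) \<longlonglongrightarrow> x - g \<theta>"
      "(\<lambda>m. defect n M ?R ?X (F m)) \<longlonglongrightarrow> (\<integral>x. (x - g \<theta>)\<^sup>2 \<partial>outcome ?R M) - crbound ?KS ?v r"
      by (rule defect_limit_optimal[OF model theta steps povm unb u2, of ?LS ?KS])
        (use LSc hKS trw gramw X_eq in \<open>auto simp flip: w_def\<close>)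
    obtain U e where U: "unitary_mat n U" and XU: "?X = U * mat_diag n (\<lambda>i. complex_of_real (e i)) * adj U"
      using hermitian_diagonalization[OF hermX] by metis
    obtain \<kappa> where \<kappa>: "0 < \<kappa>" "\<And>P. psd n P \<Longrightarrow> \<kappa> * Re (mtrace P) \<le> Re (mtrace (?R * P))"
      using posdef_trace_bound[OF pd] by metis
    \<comment> \<open>By \<open>V\<close> the defects tend to 0. The sequence approximates
      \<open>x - g \<theta>\<close>, which places the atoms at \<open>g \<theta> + e k\<close>, the
      eigenvalues of \<open>g \<theta> + ?X\<close>.\<close>
    have "M A = U * mat_diag n (\<lambda>k. if g \<theta> + e k \<in> A then 1 else 0) * adj U" if "A \<in> sets borel" for A
      by (rule povm_of_vanishing_defect[OF povm U XU \<kappa>(1) _ F(1,2) _ that]) (use \<kappa>(2) F(3) V in auto)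
    then have sm: "spectral_measure_of n (U * mat_diag n (\<lambda>k. complex_of_real (g \<theta> + e k)) * adj U) M"
      by (rule spectral_measure_of_diag[OF U])
    have Uc: "U \<in> carrier_mat n n" "U * adj U = 1\<^sub>m n" using U by (auto simp: unitary_mat_def)
    have "mat_diag n (\<lambda>k. complex_of_real (g \<theta> + e k))
        = complex_of_real (g \<theta>) \<cdot>\<^sub>m 1\<^sub>m n + mat_diag n (\<lambda>k. complex_of_real (e k))"
      by (rule eq_matI) (auto simp: mat_diag_def)
    then have "U * mat_diag n (\<lambda>k. complex_of_real (g \<theta> + e k)) * adj U
        = complex_of_real (g \<theta>) \<cdot>\<^sub>m 1\<^sub>m n + ?X"
      unfolding XU using Uc
      by (simp add: mult_add_distrib_mat[of _ n n _ n] add_mult_distrib_mat[of _ n n _ _ n]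
          mult_smult_distrib[of _ n n _ n] mult_smult_assoc_mat[of _ n n _ n] right_mult_one_mat[of _ n n])
    then have "U * mat_diag n (\<lambda>k. complex_of_real (g \<theta> + e k)) * adj U - g \<theta> \<cdot>\<^sub>m 1\<^sub>m n = ?X"
      by (simp only:) (rule eq_matI, auto)
    with sm show ?thesis by blast
  qed

  \<comment> \<open>Spectral measures of operators in the shifted span attain the bound\<close>
  moreover have "mse \<rho> M g \<theta> = ennreal (crbound ?KS ?v r)"
    if T: "spectral_measure_of n T M"
      and X: "T - g \<theta> \<cdot>\<^sub>m 1\<^sub>m n = msum n (\<lambda>i. complex_of_real (f i) \<cdot>\<^sub>m ?LS i) {1..r}" for T f
  proof -
    let ?Y = "msum n (\<lambda>i. complex_of_real (f i) \<cdot>\<^sub>m ?LS i) {1..r}"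
    define b where "b = Matrix.vec r (\<lambda>i. complex_of_real (f (Suc i)))"
    have b: "b \<in> carrier_vec r" by (simp add: b_def)
    note moments = spectral_measure_moments[OF povm T, of _ "g \<theta>", unfolded X]
    note mean = unbiased_mean[OF model steps povm unb]
    \<comment> \<open>Row \<open>i\<close> of the product is \<open>Re (tr (\<rho> L Y))\<close>
      with \<open>L\<close> the derivative of order \<open>i + 1\<close>. The derivative equation
      turns it into a difference of the traces of \<open>?Y\<close> against the shifted states,
      which are means fixed by unbiasedness.\<close>
    have "?KS *\<^sub>v b = ?v"
    proof (rule eq_vecI)
      fix i assume "i < dim_vec ?v"
      then have i: "i < r" by (simp add: vdiff_def)
      have "vec_index (?KS *\<^sub>v b) i
          = (\<Sum>j<r. complex_of_real (f (Suc j) * Re (mtrace (?R * ?LS (Suc i) * adj (?LS (Suc j))))))"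
        using i KSc by (simp add: b_def scalar_prod_def atLeast0LessThan KS_index mult.commute)
      also have "\<dots> = complex_of_real (Re (\<Sum>j=1..r. complex_of_real (f j) * mtrace (?R * ?LS (Suc i) * ?LS j * 1\<^sub>m n)))"
        using i LSc Rc LSa
        by (simp add: sum.atLeast1_atMost_eq right_mult_one_mat[of _ n n])
      also have "\<dots> = complex_of_real (Re (mtrace (?R * ?LS (Suc i) * ?Y * 1\<^sub>m n)))"
        using i LSc Rc by (subst mtrace_score_mult) auto
      also have "mtrace (?R * ?LS (Suc i) * ?Y * 1\<^sub>m n) = mtrace (?R * ?LS (Suc i) * ?Y)"
        using i LSc Rc by (simp add: right_mult_one_mat[of _ n n])
      \<comment> \<open>\<open>?Y\<close> is itself Hermitian and may therefore play the part of
        \<open>P\<close> in \<open>trS\<close>.\<close>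
      also have "Re \<dots> = Re (mtrace (?D (Suc i) * ?Y))"
        using i by (intro trS hermX) simp
      also have "\<dots> = (\<Sum>j\<le>r. diff_coeff \<delta> (Suc i) j * Re (mtrace (?\<sigma> j * ?Y)))"
        using i sc by (subst mtrace_diff_mat_mult[of _ r]) auto
      also have "\<dots> = (\<Sum>j\<le>r. diff_coeff \<delta> (Suc i) j * (g (\<theta> + real j * \<delta>) - g \<theta>))"
        by (rule sum.cong) (use moments(1)[OF sp] mean(2) in auto)
      also have "\<dots> = diff_op \<delta> (Suc i) g \<theta>"
        using i by (intro sum_diff_coeff_increment) auto
      finally show "vec_index (?KS *\<^sub>v b) i = vec_index ?v i" using i by (simp add: vdiff_def)
    qed (use KSc in \<open>auto simp: vdiff_def\<close>)
    \<comment> \<open>The differences of \<open>g\<close> now lie in the range of \<open>KS\<close>,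
      so the bound is the Gram form at \<open>b\<close>, which is the second moment of the spectral
      measure about \<open>g \<theta>\<close>.\<close>
    then have "crbound ?KS ?v r = Re (qform r ?KS b)"
      using crbound_range[OF hKS b] by simp
    also have "\<dots> = Re (mtrace (adj ?Y * ?R * ?Y))"
      by (rule gramS[OF refl, symmetric]) (simp add: b_def)
    also have "\<dots> = Re (mtrace (?R * (?Y * ?Y)))"
      unfolding hermitian_adj[OF hermX] square_assoc[OF msum_carrier Rc msum_carrier]
        mtrace_comm[OF msum_carrier square_mult_carrier[OF Rc msum_carrier]]
        square_assoc[OF Rc msum_carrier msum_carrier] ..
    also have "\<dots> = (\<integral>x. (x - g \<theta>)\<^sup>2 \<partial>outcome ?R M)"
      by (rule moments(3)[OF R, symmetric])
    finally show ?thesis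
      using mse_eq_integral[of \<rho> \<theta> M g, OF moments(2)[OF R]] by simp
  qed
  ultimately show ?thesis using bound_S bound_R by blast
qed

end
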